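(* Suppose that $f_1,\ldots,f_m$ are smooth but not necessarily convex. Let $(x_t)_{0\leq t\leq T}$ be the iterates of AdaSFW run with learning rates $\eta_t=\lambda_t^-/L$, and let $\kappa=\lambda_0^+/\lambda_0^-$. For all $t\in\{0,\ldots,T\}$, let $X_t$ be sampled uniformly at random from $\{x_0,\ldots,x_t\}$. (1) If $b_t=\left\lceil\left(\frac{G}{LD}\right)^2(t+1)\right\rceil$ and $\gamma_t=\frac{1}{(t+1)^{1/2+\nu}}$ for some $\nu\in(0,1/2)$, then for all $t\in\{0,\ldots,T-1\}$, $$\mathsf{E}[g(X_t)]\leq\frac{\left(f(x_0)-\min_{\mathcal{C}}f\right)+LD^2(K+1+\kappa/2)S}{(t+1)^{1/2-\nu}},$$ where $S=\sum_{s=0}^{+\infty}\frac{1}{(s+1)^{1+\nu}}\in\mathbb{R}_+$. (2) Alternatively, if the time horizon $T$ is fixed and, for all $t$, $b_t=\left\lceil\left(\frac{G}{LD}\right)^2T\right\rceil$ and $\gamma_t=\frac{1}{\sqrt{T}}$, then $$\mathsf{E}[g(X_{T-1})]\leq\frac{\left(f(x_0)-\min_{\mathcal{C}}f\right)+LD^2(K+1+\kappa/2)}{\sqrt{T}}.$$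
   Context: Problem. $\mathcal{C}\subset\mathbb{R}^n$ is a (nonempty) compact convex set, $f_1,\ldots,f_m\colon\mathbb{R}^n\to\mathbb{R}$ are smooth functions (differentiable with Lipschitz gradient), and $f=\frac1m\sum_{i=1}^m f_i$. Let $D=\max_{x,y\in\mathcal{C}}\|y-x\|_2$, $G=\max_{1\leq i\leq m}\max_{x\in\mathcal{C}}\|\nabla f_i(x)\|_2$, and $L=\max_{1\leq i\leq m}\sup_{x,y\in\mathcal{C},x\neq y}\|\nabla f_i(y)-\nabla f_i(x)\|_2/\|y-x\|_2$; assume $D,G,L>0$. For a symmetric positive definite matrix $H$, $\|x\|_H=\sqrt{\langle x,Hx\rangle}$. The (Frank-Wolfe) duality gap is $g(x)=\max_{v\in\mathcal{C}}\langle\nabla f(x),x-v\rangle$ for $x\in\mathcal{C}$. AdaSFW. Inputs: $T\geq1$, a (deterministic) start point $x_0\in\mathcal{C}$, batch-sizes $b_t\in\mathbb{N}\setminus\{0\}$, bounds $0<\lambda_t^-\leq\lambda_{t+1}^-\leq\lambda_{t+1}^+\leq\lambda_t^+$ for all $t$, a number of inner iterations $K\in\mathbb{N}\setminus\{0\}$, learning rates $\eta_t>0$, step-size bounds $\gamma_t\in[0,1]$. For $t=0,\ldots,T-1$: 1. Sample $i_1,\ldots,i_{b_t}$ i.i.d. uniformly from $\{1,\ldots,m\}$, independently of the past, and set $\tilde\nabla f(x_t)=\frac{1}{b_t}\sum_{j=1}^{b_t}\nabla f_{i_j}(x_t)$. 2. Choose any diagonal matrix $H_t\in\mathbb{R}^{n\times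 n}$ with all diagonal entries in $[\lambda_t^-,\lambda_t^+]$ (it may depend on all information available up to and including step 1 of iteration $t$). 3. Let $Q_t(x)=f(x_t)+\langle\tilde\nabla f(x_t),x-x_t\rangle+\frac{1}{2\eta_t}\|x-x_t\|_{H_t}^2$, so $\nabla Q_t(y)=\tilde\nabla f(x_t)+\frac{1}{\eta_t}H_t(y-x_t)$. Set $y_0^{(t)}=x_t$ and, for $k=0,\ldots,K-1$: choose $v_k^{(t)}\in\arg\min_{v\in\mathcal{C}}\langle\nabla Q_t(y_k^{(t)}),v\rangle$; set $\gamma_k^{(t)}=\min\left\{\eta_t\frac{\langle\nabla Q_t(y_k^{(t)}),y_k^{(t)}-v_k^{(t)}\rangle}{\|y_k^{(t)}-v_k^{(t)}\|_{H_t}^2},\gamma_t\right\}$ (with $\gamma_k^{(t)}=0$ if $v_k^{(t)}=y_k^{(t)}$); set $y_{k+1}^{(t)}=y_k^{(t)}+\gamma_k^{(t)}(v_k^{(t)}-y_k^{(t)})$. 4. Set $x_{t+1}=y_K^{(t)}$. All choices (of $H_t$ and of minimizers) are measurable functions of the history. The sampling of $X_t$ picks $X_t=x_s$ with an index $s$ uniform on $\{0,\ldots,t\}$ and independent of the run of the algorithm. $\mathsf{E}$ is the expectation over all the randomness (algorithm and $X_t$). *)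

theory Defs
  imports "HOL-Probability.Probability"
begin

definition grad :: "('a::euclidean_space \<Rightarrow> real) \<Rightarrow> 'a \<Rightarrow> 'a" where
  "grad f x = (THE D. GDERIV f x :> D)"

definition smooth_fun :: "('a::euclidean_space \<Rightarrow> real) \<Rightarrow> bool" where
  "smooth_fun f \<longleftrightarrow> (\<forall>x. f differentiable (at x)) \<and> (\<exists>B. B-lipschitz_on UNIV (grad f))"

definition avg :: "nat \<Rightarrow> (nat \<Rightarrow> 'a \<Rightarrow> real) \<Rightarrow> 'a \<Rightarrow> real" where
  "avg m f x = (1 / real m) * (\<Sum>i = 1..m. f i x)"

text \<open>
  On a nonempty compact set the suprema and infima over \<open>C\<close> below are of bounded sets, by
  continuity; the \<^const>\<open>Sup\<close> in \<open>smoothness_const\<close> is of a bounded set because the gradients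
  are Lipschitz, and of a nonempty one as soon as \<open>C\<close> has two points. The constant \<open>D\<close> of the
  problem is \<^const>\<open>diameter\<close>.
\<close>

definition grad_bound :: "'a::euclidean_space set \<Rightarrow> nat \<Rightarrow> (nat \<Rightarrow> 'a \<Rightarrow> real) \<Rightarrow> real" where
  "grad_bound C m f = (MAX i \<in> {1..m}. SUP x \<in> C. norm (grad (f i) x))"

definition smoothness_const :: "'a::euclidean_space set \<Rightarrow> nat \<Rightarrow> (nat \<Rightarrow> 'a \<Rightarrow> real) \<Rightarrow> real" where
  "smoothness_const C m f =
    (MAX i \<in> {1..m}.
       Sup {norm (grad (f i) y - grad (f i) x) / norm (y - x) | x y. x \<in> C \<and> y \<in> C \<and> x \<noteq> y})"

definition fw_gap :: "'a::euclidean_space set \<Rightarrow> ('a \<Rightarrow> real) \<Rightarrow> 'a \<Rightarrow> real" where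
  "fw_gap C F x = (SUP v \<in> C. grad F x \<bullet> (x - v))"

locale finite_sum_problem =
  fixes C :: "(real ^ 'n) set" and m :: nat and f :: "nat \<Rightarrow> real ^ 'n \<Rightarrow> real"
  assumes C_compact: "compact C" and C_convex: "convex C" and C_nonempty: "C \<noteq> {}"
    and m_pos: "m \<ge> 1"
    and f_smooth: "\<And>i. i \<in> {1..m} \<Longrightarrow> smooth_fun (f i)"
    and D_pos: "diameter C > 0"
    and G_pos: "grad_bound C m f > 0"
    and L_pos: "smoothness_const C m f > 0"

definition mnorm :: "real ^ 'n ^ 'n \<Rightarrow> real ^ 'n \<Rightarrow> real" where
  "mnorm A x = sqrt (x \<bullet> (A *v x))"

text \<open>The subproblem objective \<open>Q\<close> at the point \<open>x\<close>, with value \<open>c\<close>, gradient estimate \<open>g\<close>,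
  learning rate \<open>e\<close> and metric \<open>A\<close>.\<close>

definition quad_model ::
    "real \<Rightarrow> real ^ 'n \<Rightarrow> real \<Rightarrow> real ^ 'n ^ 'n \<Rightarrow> real ^ 'n \<Rightarrow> real ^ 'n \<Rightarrow> real" where
  "quad_model c g e A x z = c + g \<bullet> (z - x) + 1 / (2 * e) * (mnorm A (z - x))\<^sup>2"

text \<open>
  A run of AdaSFW on a probability space \<open>M\<close>. All random objects are functions of the outcome
  \<open>w\<close>: \<open>idx t j w\<close> is the \<open>j\<close>-th index sampled in iteration \<open>t\<close> (numbered from \<open>0\<close>), and
  \<open>y t k w\<close>, \<open>v t k w\<close> are the inner iterates and minimizers of iteration \<open>t\<close>.

  The history is a filtration: \<open>F t\<close> is the information available when iteration \<open>t\<close> begins,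
  and \<open>F (Suc t)\<close> that available before the batch of iteration \<open>t + 1\<close> is drawn. Each batch is
  independent of \<open>F t\<close>, and the choices made in iteration \<open>t\<close> are \<open>F (Suc t)\<close>-measurable.
  Letting \<open>F t\<close> be generated by \<open>idx s j\<close>, \<open>s < t\<close>, gives the case in which every choice is a
  function of the indices sampled so far; a larger filtration allows randomized choices.
\<close>

locale adasfw = finite_sum_problem C m f + prob_space M + filtration "space M" F
  for C :: "(real ^ 'n) set" and m :: nat and f :: "nat \<Rightarrow> real ^ 'n \<Rightarrow> real"
    and M :: "'w measure" and F :: "nat \<Rightarrow> 'w measure" +
  fixes T :: nat and x0 :: "real ^ 'n" and b :: "nat \<Rightarrow> nat"
    and lm lp :: "nat \<Rightarrow> real" and K :: nat and \<eta> \<gamma> :: "nat \<Rightarrow> real"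
    and idx :: "nat \<Rightarrow> nat \<Rightarrow> 'w \<Rightarrow> nat"
    and H :: "nat \<Rightarrow> 'w \<Rightarrow> real ^ 'n ^ 'n"
    and y v :: "nat \<Rightarrow> nat \<Rightarrow> 'w \<Rightarrow> real ^ 'n"
    and x :: "nat \<Rightarrow> 'w \<Rightarrow> real ^ 'n"
  fixes sgrad :: "nat \<Rightarrow> 'w \<Rightarrow> real ^ 'n" and Q :: "nat \<Rightarrow> 'w \<Rightarrow> real ^ 'n \<Rightarrow> real"
  defines "sgrad \<equiv> \<lambda>t w. (1 / real (b t)) *\<^sub>R (\<Sum>j<b t. grad (f (idx t j w)) (x t w))"
    and "Q \<equiv> \<lambda>t w. quad_model (avg m f (x t w)) (sgrad t w) (\<eta> t) (H t w) (x t w)"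
  assumes T_pos: "T \<ge> 1" and x0_in: "x0 \<in> C" and b_pos: "\<And>t. b t \<noteq> 0"
    and lambda: "\<And>t. 0 < lm t \<and> lm t \<le> lm (Suc t) \<and> lm (Suc t) \<le> lp (Suc t) \<and> lp (Suc t) \<le> lp t"
    and K_pos: "K \<noteq> 0" and eta_pos: "\<And>t. \<eta> t > 0" and gamma: "\<And>t. \<gamma> t \<in> {0..1}"
    and F_sub: "\<And>t. sets (F t) \<subseteq> sets M"
    and idx_measurable: "\<And>t j. t < T \<Longrightarrow> j < b t \<Longrightarrow> idx t j \<in> F (Suc t) \<rightarrow>\<^sub>M count_space {1..m}"
    and idx_uniform: "\<And>t j. t < T \<Longrightarrow> j < b t \<Longrightarrow>
          distr M (count_space {1..m}) (idx t j) = uniform_count_measure {1..m}"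
    and idx_indep: "\<And>t. t < T \<Longrightarrow> indep_vars (\<lambda>_. count_space {1..m}) (idx t) {..<b t}"
    and idx_fresh: "\<And>t. t < T \<Longrightarrow>
          indep_set (sets (F t))
            (sets (vimage_algebra (space M) (\<lambda>w. \<lambda>j\<in>{..<b t}. idx t j w)
                     (PiM {..<b t} (\<lambda>_. count_space {1..m}))))"
    and H_measurable: "\<And>t. t < T \<Longrightarrow> H t \<in> borel_measurable (F (Suc t))"
    and H_diagonal: "\<And>t w p q. t < T \<Longrightarrow> w \<in> space M \<Longrightarrow> p \<noteq> q \<Longrightarrow> H t w $ p $ q = 0"
    and H_bounds: "\<And>t w p. t < T \<Longrightarrow> w \<in> space M \<Longrightarrow> H t w $ p $ p \<in> {lm t..lp t}"
    and y_0: "\<And>t w. t < T \<Longrightarrow> w \<in> space M \<Longrightarrow> y t 0 w = x t w"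
    and v_measurable: "\<And>t k. t < T \<Longrightarrow> k < K \<Longrightarrow> v t k \<in> borel_measurable (F (Suc t))"
    and v_argmin: "\<And>t k w. t < T \<Longrightarrow> k < K \<Longrightarrow> w \<in> space M \<Longrightarrow>
          is_arg_min (\<lambda>u. grad (Q t w) (y t k w) \<bullet> u) (\<lambda>u. u \<in> C) (v t k w)"
    and y_Suc: "\<And>t k w. t < T \<Longrightarrow> k < K \<Longrightarrow> w \<in> space M \<Longrightarrow>
          y t (Suc k) w = y t k w +
            (if v t k w = y t k w then 0
             else min (\<eta> t * (grad (Q t w) (y t k w) \<bullet> (y t k w - v t k w))
                         / (mnorm (H t w) (y t k w - v t k w))\<^sup>2)
                      (\<gamma> t))
            *\<^sub>R (v t k w - y t k w)"
    and x_0: "\<And>w. w \<in> space M \<Longrightarrow> x 0 w = x0"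
    and x_Suc: "\<And>t w. t < T \<Longrightarrow> w \<in> space M \<Longrightarrow> x (Suc t) w = y t K w"

definition (in prob_space) fresh_uniform_index :: "'a measure \<Rightarrow> nat \<Rightarrow> ('a \<Rightarrow> nat) \<Rightarrow> bool" where
  "fresh_uniform_index A t \<tau> \<longleftrightarrow>
     \<tau> \<in> M \<rightarrow>\<^sub>M count_space {0..t} \<and>
     distr M (count_space {0..t}) \<tau> = uniform_count_measure {0..t} \<and>
     indep_set (sets A) (sets (vimage_algebra (space M) \<tau> (count_space {0..t})))"

end

theory Submission
  imports Defs
begin

text \<open>
  Since \<open>\<eta> t = lm t / L\<close>, the descent lemma bounds \<open>f (x (t + 1))\<close> by the model value
  \<open>Q t (x (t + 1))\<close> plus the error of the sampled gradient tested against \<open>x (t + 1) - x t\<close>,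
  a vector of length at most \<open>K \<gamma> t D\<close>. The clipped steps never increase \<open>Q t\<close>, and the
  first of them is at least as good as the step of size \<open>\<gamma> t\<close>, so
    \<open>\<gamma> t g(x t) \<le> f(x t) - f(x (t + 1)) + (K + 1) \<gamma> t D \<parallel>error\<parallel> + (\<gamma> t)\<^sup>2 L D\<^sup>2 \<kappa> / 2\<close>
  holds for every outcome. The error of a fresh i.i.d. batch has mean norm at most
  \<open>G / sqrt (b t)\<close>, which the batch sizes keep below \<open>L D / sqrt (t + 1)\<close> or \<open>L D / sqrt T\<close>.
  Taking expectations, telescoping, and using that the \<open>\<gamma> s\<close>, \<open>s \<le> t\<close>, are at least \<open>\<gamma> t\<close>
  bounds the average gap.
\<close>

section \<open>Gradients and the descent lemma\<close>

lemma GDERIV_unique: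
  assumes "GDERIV f x :> D" "GDERIV f x :> E"
  shows "D = E"
proof -
  have "(\<lambda>h. h \<bullet> D) = (\<lambda>h. h \<bullet> E)"
    using assms unfolding gderiv_def by (rule has_derivative_unique)
  then show ?thesis by (metis vector_eq_ldot)
qed

lemma grad_eqI: "GDERIV f x :> D \<Longrightarrow> grad f x = D"
  unfolding grad_def by (blast intro: the_equality GDERIV_unique)

lemma GDERIV_grad:
  fixes f :: "'a::euclidean_space \<Rightarrow> real"
  assumes "f differentiable (at x)"
  shows "GDERIV f x :> grad f x"
proof -
  obtain f' where f': "(f has_derivative f') (at x)"
    using assms by (auto simp: differentiable_def)
  interpret linear f' using f' by (rule has_derivative_linear)
  \<comment> \<open>Riesz representation: a linear functional on a Euclidean space is the inner
    product with its adjoint applied to 1.\<close>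
  have "f' = (\<lambda>h. h \<bullet> adjoint f' 1)"
    using adjoint_works[OF linear_axioms, of _ 1] by auto
  then have "GDERIV f x :> adjoint f' 1"
    using f' by (simp add: gderiv_def)
  then show ?thesis by (simp add: grad_eqI)
qed

text \<open>Along the segment from \<open>x\<close> to \<open>y\<close>, \<open>f\<close> minus the
  linear and quadratic terms of the bound has nonpositive derivative, by Cauchy-Schwarz and the
  Lipschitz condition; no integral is taken. The gradient is compared with its value at
  \<open>x\<close> and only inside \<open>C\<close>, because \<open>smoothness_const\<close> sees
  only points of \<open>C\<close>.\<close>

lemma descent_lemma:
  fixes f :: "'a::euclidean_space \<Rightarrow> real"
  assumes "convex C" and x: "x \<in> C" and y: "y \<in> C"
    and deriv: "\<And>z. z \<in> C \<Longrightarrow> GDERIV f z :> g z"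
    and lips: "\<And>z. z \<in> C \<Longrightarrow> norm (g z - g x) \<le> L * norm (z - x)"
  shows "f y \<le> f x + g x \<bullet> (y - x) + L / 2 * (norm (y - x))\<^sup>2"
proof -
  define d where "d = y - x"
  define \<phi> where "\<phi> s = f (x + s *\<^sub>R d) - s * (g x \<bullet> d) - L / 2 * s\<^sup>2 * (norm d)\<^sup>2" for s
  have inC: "x + s *\<^sub>R d \<in> C" if "0 \<le> s" "s \<le> 1" for s
  proof -
    have "(1 - s) *\<^sub>R x + s *\<^sub>R y \<in> C"
      using that x y \<open>convex C\<close> by (simp add: convex_alt)
    then show ?thesis by (simp add: d_def algebra_simps)
  qed
  have "\<phi> 1 \<le> \<phi> 0"
  proof (rule DERIV_nonpos_imp_nonincreasing[where f = \<phi> and a = 0 and b = 1])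
    fix s :: real assume s: "0 \<le> s" "s \<le> 1"
    let ?z = "x + s *\<^sub>R d"
    have "(f has_derivative (\<lambda>h. h \<bullet> g ?z)) (at ?z)"
      using deriv[OF inC[OF s]] by (simp add: gderiv_def)
    moreover have "((\<lambda>s. x + s *\<^sub>R d) has_derivative (\<lambda>h. h *\<^sub>R d)) (at s)"
      by (auto intro!: derivative_eq_intros)
    ultimately have "((\<lambda>s. f (x + s *\<^sub>R d)) has_derivative (\<lambda>h. (h *\<^sub>R d) \<bullet> g ?z)) (at s)"
      by (rule has_derivative_compose[rotated])
    then have fd: "((\<lambda>s. f (x + s *\<^sub>R d)) has_real_derivative (g ?z \<bullet> d)) (at s)"
      by (rule has_derivative_imp_has_field_derivative) (simp add: inner_commute)
    have "(\<phi> has_real_derivative (g ?z \<bullet> d - g x \<bullet> d - L * s * (norm d)\<^sup>2)) (at s)"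
      unfolding \<phi>_def[abs_def] by (rule derivative_eq_intros fd refl | simp)+
    moreover have "g ?z \<bullet> d - g x \<bullet> d - L * s * (norm d)\<^sup>2 \<le> 0"
    proof -
      have "(g ?z - g x) \<bullet> d \<le> norm (g ?z - g x) * norm d"
        by (rule norm_cauchy_schwarz)
      also have "\<dots> \<le> (L * norm (?z - x)) * norm d"
        by (intro mult_right_mono lips inC s norm_ge_zero)
      also have "\<dots> = L * s * (norm d)\<^sup>2"
        using s by (simp add: power2_eq_square)
      finally show ?thesis by (simp add: inner_diff_left)
    qed
    ultimately show "\<exists>D. (\<phi> has_real_derivative D) (at s) \<and> D \<le> 0" by blast
  qed simp
  then show ?thesis by (simp add: \<phi>_def d_def)
qed

text \<open>Each supremum is a value of the support function of \<open>C\<close>. For fixed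
  \<open>z\<close> the two inner products differ by at most \<open>R * norm (u - w)\<close>, and
  this bound is uniform in \<open>z\<close>. The resulting continuity is what makes the gap Borel
  measurable later.\<close>

lemma abs_SUP_inner_diff_le:
  fixes C :: "'a::real_inner set"
  assumes "C \<noteq> {}" and bound: "\<And>z. z \<in> C \<Longrightarrow> norm z \<le> R"
  shows "\<bar>(SUP z\<in>C. u \<bullet> z) - (SUP z\<in>C. w \<bullet> z)\<bar> \<le> R * norm (u - w)"
proof -
  have ub: "a \<bullet> z \<le> norm a * R" if "z \<in> C" for a z
    using norm_cauchy_schwarz[of a z] mult_left_mono[OF bound[OF that], of "norm a"] by simp
  then have bdd: "bdd_above ((\<lambda>z. a \<bullet> z) ` C)" for a
    by (intro bdd_aboveI2[where M = "norm a * R"])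
  have le: "(SUP z\<in>C. a \<bullet> z) \<le> (SUP z\<in>C. b \<bullet> z) + R * norm (a - b)" for a b
  proof (rule cSUP_least[OF \<open>C \<noteq> {}\<close>])
    fix z assume z: "z \<in> C"
    have "a \<bullet> z = b \<bullet> z + (a - b) \<bullet> z" by (simp add: inner_diff_left)
    also have "\<dots> \<le> (SUP z\<in>C. b \<bullet> z) + norm (a - b) * R"
      by (intro add_mono cSUP_upper z bdd ub)
    finally show "a \<bullet> z \<le> (SUP z\<in>C. b \<bullet> z) + R * norm (a - b)" by (simp add: mult.commute)
  qed
  show ?thesis
    using le[of u w] le[of w u] by (simp add: norm_minus_commute abs_le_iff)
qed

lemma continuous_on_SUP_inner:
  fixes C :: "'a::real_inner set"
  assumes "bounded C" "C \<noteq> {}"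
  shows "continuous_on UNIV (\<lambda>u. SUP z\<in>C. u \<bullet> z)"
proof -
  obtain R where R: "\<And>z. z \<in> C \<Longrightarrow> norm z \<le> R" and "R > 0"
    using \<open>bounded C\<close> by (auto simp: bounded_pos)
  have "R-lipschitz_on UNIV (\<lambda>u. SUP z\<in>C. u \<bullet> z)"
    using abs_SUP_inner_diff_le[OF \<open>C \<noteq> {}\<close> R] \<open>R > 0\<close>
    by (intro lipschitz_onI) (auto simp: dist_norm)
  then show ?thesis by (rule lipschitz_on_continuous_on)
qed

section \<open>Component gradients, their average and the Frank-Wolfe gap on
  \<open>C\<close>\<close>

context finite_sum_problem
begin

abbreviation "favg \<equiv> avg m f"
abbreviation "Dc \<equiv> diameter C"
abbreviation "Gc \<equiv> grad_bound C m f"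
abbreviation "Lc \<equiv> smoothness_const C m f"

lemma dist_le_diameter: "u \<in> C \<Longrightarrow> z \<in> C \<Longrightarrow> norm (u - z) \<le> Dc"
  using diameter_bounded_bound[of C u z] C_compact by (simp add: compact_imp_bounded dist_norm)

lemma GDERIV_component: "i \<in> {1..m} \<Longrightarrow> GDERIV (f i) z :> grad (f i) z"
  using f_smooth by (auto simp: smooth_fun_def intro: GDERIV_grad)

lemma continuous_on_grad_component: "i \<in> {1..m} \<Longrightarrow> continuous_on A (grad (f i))"
  using f_smooth[of i] by (auto simp: smooth_fun_def
      intro: continuous_on_subset[OF lipschitz_on_continuous_on])

lemma norm_grad_component_le:
  assumes i: "i \<in> {1..m}" and z: "z \<in> C"
  shows "norm (grad (f i) z) \<le> Gc"
proof -
  have "compact ((\<lambda>x. norm (grad (f i) x)) ` C)"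
    by (intro compact_continuous_image continuous_intros continuous_on_grad_component C_compact i)
  then have "bdd_above ((\<lambda>x. norm (grad (f i) x)) ` C)"
    by (simp add: bounded_imp_bdd_above compact_imp_bounded)
  then have "norm (grad (f i) z) \<le> (SUP x\<in>C. norm (grad (f i) x))"
    by (intro cSUP_upper z)
  also have "\<dots> \<le> Gc"
    unfolding grad_bound_def using i by (intro Max_ge) auto
  finally show ?thesis .
qed

lemma norm_grad_component_diff_le:
  assumes i: "i \<in> {1..m}" and z: "z \<in> C" and u: "u \<in> C"
  shows "norm (grad (f i) z - grad (f i) u) \<le> Lc * norm (z - u)"
proof (cases "z = u")
  case False
  let ?S = "{norm (grad (f i) y - grad (f i) x) / norm (y - x) | x y. x \<in> C \<and> y \<in> C \<and> x \<noteq> y}"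
  obtain B where B: "B-lipschitz_on UNIV (grad (f i))"
    using f_smooth[OF i] by (auto simp: smooth_fun_def)
  \<comment> \<open>The global Lipschitz constant \<open>B\<close> only certifies that the quotients
    are bounded, so that \<open>Sup\<close> really bounds them; the constant that survives is
    \<open>Lc\<close>.\<close>
  have "bdd_above ?S"
    using lipschitz_onD[OF B]
    by (intro bdd_aboveI[where M = B]) (auto simp: dist_norm pos_divide_le_eq)
  then have "norm (grad (f i) z - grad (f i) u) / norm (z - u) \<le> Sup ?S"
    using z u False by (intro cSup_upper) auto
  also have "\<dots> \<le> Lc"
    unfolding smoothness_const_def using i by (intro Max_ge) auto
  finally show ?thesis using False by (simp add: divide_simps)
qed simp

lemma GDERIV_avg: "GDERIV favg z :> (1 / real m) *\<^sub>R (\<Sum>i = 1..m. grad (f i) z)"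
proof -
  have "((\<lambda>z. (1 / real m) * (\<Sum>i = 1..m. f i z)) has_derivative
      (\<lambda>h. (1 / real m) * (\<Sum>i = 1..m. h \<bullet> grad (f i) z))) (at z)"
    using GDERIV_component unfolding gderiv_def
    by (intro has_derivative_mult_right has_derivative_sum) auto
  then show ?thesis
    unfolding gderiv_def avg_def[abs_def] by (simp add: inner_sum_right)
qed

lemma grad_avg: "grad favg z = (1 / real m) *\<^sub>R (\<Sum>i = 1..m. grad (f i) z)"
  by (rule grad_eqI[OF GDERIV_avg])

lemma continuous_on_grad_avg: "continuous_on A (grad favg)"
  unfolding grad_avg[abs_def] by (intro continuous_intros continuous_on_grad_component)

lemma continuous_on_avg: "continuous_on A favg"
  using GDERIV_avg unfolding gderiv_def
  by (intro continuous_at_imp_continuous_on ballI has_derivative_continuous)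

lemma norm_grad_avg_diff_le:
  assumes "z \<in> C" "u \<in> C"
  shows "norm (grad favg z - grad favg u) \<le> Lc * norm (z - u)"
proof -
  have "norm (grad favg z - grad favg u)
      = (1 / real m) * norm (\<Sum>i = 1..m. grad (f i) z - grad (f i) u)"
    by (simp add: grad_avg sum_subtractf flip: scaleR_diff_right)
  also have "\<dots> \<le> (1 / real m) * (\<Sum>i = 1..m. Lc * norm (z - u))"
    using assms by (intro mult_left_mono sum_norm_le norm_grad_component_diff_le) auto
  also have "\<dots> = Lc * norm (z - u)" using m_pos by simp
  finally show ?thesis .
qed

lemma norm_grad_avg_le:
  assumes "z \<in> C"
  shows "norm (grad favg z) \<le> Gc"
proof -
  have "norm (grad favg z) \<le> (1 / real m) * (\<Sum>i = 1..m. Gc)"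
    unfolding grad_avg norm_scaleR using assms
    by (intro mult_mono sum_norm_le norm_grad_component_le) auto
  also have "\<dots> = Gc" using m_pos by simp
  finally show ?thesis .
qed

lemma avg_descent:
  assumes "z \<in> C" "u \<in> C"
  shows "favg u \<le> favg z + grad favg z \<bullet> (u - z) + Lc / 2 * (norm (u - z))\<^sup>2"
  using assms GDERIV_avg grad_avg norm_grad_avg_diff_le
  by (intro descent_lemma[OF C_convex]) auto

lemma INF_avg_le: "z \<in> C \<Longrightarrow> (INF u\<in>C. favg u) \<le> favg z"
  by (intro cINF_lower bounded_imp_bdd_below compact_imp_bounded compact_continuous_image
      continuous_on_avg C_compact)

lemma bdd_above_gap: "bdd_above ((\<lambda>v. grad favg z \<bullet> (z - v)) ` C)"
  by (intro bounded_imp_bdd_above compact_imp_bounded compact_continuous_image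
      continuous_intros C_compact)

text \<open>With the term free of \<open>v\<close> split off, the rest is the support function of
  \<open>C\<close> at the negative gradient, so continuity of the gap reduces to composing
  continuous maps.\<close>

lemma fw_gap_eq: "fw_gap C favg z = grad favg z \<bullet> z + (SUP v\<in>C. (- grad favg z) \<bullet> v)"
proof -
  have "bdd_above ((\<lambda>v. (- grad favg z) \<bullet> v) ` C)"
    by (intro bounded_imp_bdd_above compact_imp_bounded compact_continuous_image
        continuous_intros C_compact)
  then have "(SUP v\<in>C. grad favg z \<bullet> z + (- grad favg z) \<bullet> v)
      = grad favg z \<bullet> z + (SUP v\<in>C. (- grad favg z) \<bullet> v)"
    using C_nonempty by (intro Sup_add_eq)
  then show ?thesis by (simp add: fw_gap_def inner_diff_right)
qed

lemma continuous_on_fw_gap: "continuous_on UNIV (fw_gap C favg)"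
proof -
  have "continuous_on UNIV (\<lambda>u. SUP v\<in>C. u \<bullet> v)"
    using C_compact C_nonempty by (intro continuous_on_SUP_inner compact_imp_bounded)
  then have "continuous_on UNIV (\<lambda>z. SUP v\<in>C. (- grad favg z) \<bullet> v)"
    by (rule continuous_on_compose2) (auto intro!: continuous_intros continuous_on_grad_avg)
  then show ?thesis
    unfolding fw_gap_eq[abs_def] by (intro continuous_on_add continuous_on_inner
        continuous_on_grad_avg continuous_on_id)
qed

lemma fw_gap_attained:
  obtains u where "u \<in> C" "fw_gap C favg z = grad favg z \<bullet> (z - u)"
proof -
  have "continuous_on C (\<lambda>v. grad favg z \<bullet> (z - v))" by (intro continuous_intros)
  then obtain u where u: "u \<in> C" "\<And>v. v \<in> C \<Longrightarrow> grad favg z \<bullet> (z - v) \<le> grad favg z \<bullet> (z - u)"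
    using continuous_attains_sup[OF C_compact C_nonempty] by blast
  then have "fw_gap C favg z = grad favg z \<bullet> (z - u)"
    unfolding fw_gap_def by (intro cSup_eq_maximum) auto
  with u that show ?thesis by blast
qed

text \<open>The choice \<open>v = z\<close> gives the lower bound, which later allows each weight
  \<open>\<gamma> s\<close> to be lowered to \<open>\<gamma> t\<close>; both bounds together give
  integrability of the gap.\<close>

lemma fw_gap_bounds:
  assumes "z \<in> C"
  shows "0 \<le> fw_gap C favg z" "fw_gap C favg z \<le> Gc * Dc"
proof -
  show "0 \<le> fw_gap C favg z"
    unfolding fw_gap_def using bdd_above_gap assms by (intro cSUP_upper2[of _ C z]) auto
  obtain u where u: "u \<in> C" "fw_gap C favg z = grad favg z \<bullet> (z - u)"
    by (rule fw_gap_attained)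
  have "grad favg z \<bullet> (z - u) \<le> norm (grad favg z) * norm (z - u)"
    by (rule norm_cauchy_schwarz)
  also have "\<dots> \<le> Gc * Dc"
    using assms u G_pos by (intro mult_mono norm_grad_avg_le dist_le_diameter) auto
  finally show "fw_gap C favg z \<le> Gc * Dc" using u by simp
qed

end

section \<open>The deterministic one-step inequality\<close>

lemma diagonal_mult_vec:
  fixes A :: "real ^ 'n ^ 'n"
  assumes "\<And>p q. p \<noteq> q \<Longrightarrow> A $ p $ q = 0"
  shows "(A *v d) $ p = A $ p $ p * d $ p"
proof -
  have "(A *v d) $ p = (\<Sum>q\<in>UNIV. if q = p then A $ p $ p * d $ p else 0)"
    unfolding matrix_vector_mult_def vec_lambda_beta using assms by (intro sum.cong) auto
  then show ?thesis by simp
qed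

lemma mnorm_diagonal_bounds:
  fixes A :: "real ^ 'n ^ 'n"
  assumes diag: "\<And>p q. p \<noteq> q \<Longrightarrow> A $ p $ q = 0"
    and bounds: "\<And>p. A $ p $ p \<in> {l..u}" and "0 \<le> l"
  shows "(mnorm A d)\<^sup>2 = d \<bullet> (A *v d)"
    and "l * (norm d)\<^sup>2 \<le> (mnorm A d)\<^sup>2" and "(mnorm A d)\<^sup>2 \<le> u * (norm d)\<^sup>2"
proof -
  have eq: "d \<bullet> (A *v d) = (\<Sum>p\<in>UNIV. A $ p $ p * (d $ p)\<^sup>2)"
    by (simp add: inner_vec_def diagonal_mult_vec[OF diag] power2_eq_square mult.left_commute)
  have norm2: "(norm d)\<^sup>2 = (\<Sum>p\<in>UNIV. (d $ p)\<^sup>2)"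
    unfolding power2_norm_eq_inner by (simp add: inner_vec_def power2_eq_square)
  have lower: "l * (norm d)\<^sup>2 \<le> d \<bullet> (A *v d)"
    unfolding eq norm2 sum_distrib_left using bounds by (intro sum_mono mult_right_mono) auto
  have upper: "d \<bullet> (A *v d) \<le> u * (norm d)\<^sup>2"
    unfolding eq norm2 sum_distrib_left using bounds by (intro sum_mono mult_right_mono) auto
  \<comment> \<open>Squaring a square root returns its argument only when that argument is
    nonnegative.\<close>
  have "0 \<le> d \<bullet> (A *v d)"
    using lower \<open>0 \<le> l\<close> by (meson mult_nonneg_nonneg order_trans zero_le_power2)
  then show sq: "(mnorm A d)\<^sup>2 = d \<bullet> (A *v d)" by (simp add: mnorm_def)
  show "l * (norm d)\<^sup>2 \<le> (mnorm A d)\<^sup>2" "(mnorm A d)\<^sup>2 \<le> u * (norm d)\<^sup>2"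
    using lower upper by (simp_all add: sq)
qed

lemma diagonal_inner_commute:
  fixes A :: "real ^ 'n ^ 'n"
  assumes diag: "\<And>p q. p \<noteq> q \<Longrightarrow> A $ p $ q = 0"
  shows "c \<bullet> (A *v d) = d \<bullet> (A *v c)"
  by (simp add: inner_vec_def diagonal_mult_vec[OF diag] mult.assoc mult.left_commute mult.commute)

text \<open>The product rule yields two bilinear terms; a diagonal matrix is symmetric, so they
  agree and absorb the factor 1/2.\<close>

lemma grad_quad_model:
  fixes A :: "real ^ 'n ^ 'n"
  assumes diag: "\<And>p q. p \<noteq> q \<Longrightarrow> A $ p $ q = 0"
    and pos: "\<And>p. 0 \<le> A $ p $ p"
  shows "grad (quad_model c g e A x) z = g + (1 / e) *\<^sub>R (A *v (z - x))"
proof (rule grad_eqI)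
  \<comment> \<open>The diagonal is placed in the interval from 0 to its largest entry, which exists
    because the index type is finite.\<close>
  have sq: "(mnorm A d)\<^sup>2 = d \<bullet> (A *v d)" for d
    using pos mnorm_diagonal_bounds(1)[OF diag, of 0 "Max (range (\<lambda>p. A $ p $ p))"] by simp
  have lin: "((\<lambda>z. A *v (z - x)) has_derivative (\<lambda>h. A *v h)) (at z)"
    by (rule bounded_linear.has_derivative[OF matrix_vector_mul_bounded_linear])
      (auto intro!: derivative_eq_intros)
  have "((\<lambda>z. c + g \<bullet> (z - x) + 1 / (2 * e) * ((z - x) \<bullet> (A *v (z - x)))) has_derivative
      (\<lambda>h. g \<bullet> h + 1 / (2 * e) * ((z - x) \<bullet> (A *v h) + h \<bullet> (A *v (z - x))))) (at z)"
    by (rule derivative_eq_intros lin refl | simp)+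
  moreover have "(\<lambda>h. g \<bullet> h + 1 / (2 * e) * ((z - x) \<bullet> (A *v h) + h \<bullet> (A *v (z - x))))
      = (\<lambda>h. h \<bullet> (g + (1 / e) *\<^sub>R (A *v (z - x))))"
    by (simp add: diagonal_inner_commute[OF diag, of "z - x"] inner_add_right inner_commute[of g])
  ultimately show "GDERIV (quad_model c g e A x) z :> g + (1 / e) *\<^sub>R (A *v (z - x))"
    unfolding gderiv_def quad_model_def[abs_def] sq by simp
qed

text \<open>The second-order expansion of a quadratic is exact. Along a direction \<open>d\<close>
  the model is therefore a parabola in \<open>s\<close>, and comparing step sizes becomes a
  one-dimensional question.\<close>

lemma quad_model_step:
  fixes A :: "real ^ 'n ^ 'n"
  assumes diag: "\<And>p q. p \<noteq> q \<Longrightarrow> A $ p $ q = 0"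
    and pos: "\<And>p. 0 \<le> A $ p $ p" and "e \<noteq> 0"
  shows "quad_model c g e A x (z + s *\<^sub>R d) =
    quad_model c g e A x z + s * (grad (quad_model c g e A x) z \<bullet> d) + s\<^sup>2 / 2 * ((mnorm A d)\<^sup>2 / e)"
proof -
  have sq: "(mnorm A d)\<^sup>2 = d \<bullet> (A *v d)" for d
    using pos mnorm_diagonal_bounds(1)[OF diag, of 0 "Max (range (\<lambda>p. A $ p $ p))"] by simp
  define r where "r = z - x"
  have Q: "quad_model c g e A x z' = c + g \<bullet> (z' - x) + 1 / (2 * e) * ((z' - x) \<bullet> (A *v (z' - x)))" for z'
    by (simp add: quad_model_def sq)
  have grad: "grad (quad_model c g e A x) z \<bullet> d = g \<bullet> d + (1 / e) * ((A *v r) \<bullet> d)"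
    by (simp add: grad_quad_model[OF diag pos] r_def inner_add_left)
  have z: "z + s *\<^sub>R d - x = r + s *\<^sub>R d" by (simp add: r_def)
  have square: "(r + s *\<^sub>R d) \<bullet> (A *v (r + s *\<^sub>R d))
      = r \<bullet> (A *v r) + 2 * s * ((A *v r) \<bullet> d) + s\<^sup>2 * (d \<bullet> (A *v d))"
    by (simp add: matrix_vector_right_distrib matrix_vector_mult_scaleR inner_add_left inner_add_right
        diagonal_inner_commute[OF diag, of r d] inner_commute[of "A *v r"] power2_eq_square algebra_simps)
  show ?thesis
    unfolding Q grad z r_def[symmetric] square sq
    using \<open>e \<noteq> 0\<close> by (simp add: inner_add_right field_simps)
qed

text \<open>The parabola has its vertex at \<open>a / c\<close>, so clipping the vertex at
  \<open>\<gamma>\<close> minimizes it over all \<open>r \<le> \<gamma>\<close>. If the vertex is at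
  most \<open>\<gamma>\<close>, the difference is a completed square; otherwise the parabola falls
  up to \<open>\<gamma>\<close> and the difference has the nonnegative factor
  \<open>\<gamma> - r\<close>.\<close>

lemma clipped_step_optimal:
  fixes a c \<gamma> r :: real
  assumes "0 < c" "0 \<le> r" "r \<le> \<gamma>"
  defines "s \<equiv> min (a / c) \<gamma>"
  shows "s\<^sup>2 / 2 * c - s * a \<le> r\<^sup>2 / 2 * c - r * a"
proof (cases "a / c \<le> \<gamma>")
  case True
  then have "a = s * c" using \<open>0 < c\<close> by (simp add: s_def)
  then have "r\<^sup>2 / 2 * c - r * a - (s\<^sup>2 / 2 * c - s * a) = c / 2 * (r - s)\<^sup>2"
    by (simp add: power2_eq_square field_simps)
  also have "\<dots> \<ge> 0" using \<open>0 < c\<close> by simp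
  finally show ?thesis by simp
next
  case False
  then have s: "s = \<gamma>" by (simp add: s_def)
  have "\<gamma> * c \<le> a" using False \<open>0 < c\<close> by (simp add: pos_less_divide_eq not_le less_imp_le)
  moreover have "c * r \<le> \<gamma> * c" using assms by (simp add: mult.commute)
  ultimately have "\<gamma> * c + c * r \<le> a * 2" by linarith
  then have "0 \<le> (\<gamma> - r) * (a - c * (\<gamma> + r) / 2)"
    using assms by (intro mult_nonneg_nonneg) (auto simp: algebra_simps)
  also have "\<dots> = r\<^sup>2 / 2 * c - r * a - (s\<^sup>2 / 2 * c - s * a)"
    by (simp add: s power2_eq_square field_simps)
  finally show ?thesis by simp
qed

section \<open>Progress of the inner iterations on the model\<close>

context adasfw
begin

abbreviation "err t w \<equiv> sgrad t w - grad favg (x t w)"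

lemma lm_pos: "0 < lm t" using lambda by blast

text \<open>The lower bounds increase and the upper ones decrease, so the conditioning is worst at
  the start and one constant serves all iterations.\<close>

lemma lp_lm_ratio: "lp t / lm t \<le> lp 0 / lm 0"
proof -
  have "lm 0 \<le> lm t" by (rule lift_Suc_mono_le[of lm]) (use lambda in auto)
  moreover have "lp t \<le> lp 0" by (rule lift_Suc_antimono_le[of lp]) (use lambda in auto)
  moreover have "0 < lp 0" using lambda[of 0] by linarith
  ultimately show ?thesis using lm_pos by (intro frac_le) auto
qed

context
  fixes t w
  assumes t: "t < T" and w: "w \<in> space M"
begin

lemma H_nonneg: "0 \<le> H t w $ p $ p"
  using H_bounds[OF t w, of p] lm_pos[of t] by auto

lemmas mnorm_H = mnorm_diagonal_bounds[OF H_diagonal[OF t w] H_bounds[OF t w] less_imp_le[OF lm_pos]]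

lemma grad_Q: "grad (Q t w) z = sgrad t w + (1 / \<eta> t) *\<^sub>R (H t w *v (z - x t w))"
  unfolding Q_def by (rule grad_quad_model[OF H_diagonal[OF t w] H_nonneg])

lemma Q_step:
  "Q t w (z + s *\<^sub>R d) = Q t w z + s * (grad (Q t w) z \<bullet> d) + s\<^sup>2 / 2 * ((mnorm (H t w) d)\<^sup>2 / \<eta> t)"
  unfolding Q_def using eta_pos[of t] by (intro quad_model_step[OF H_diagonal[OF t w] H_nonneg]) auto

lemma Q_at_x: "Q t w (x t w) = favg (x t w)"
  by (simp add: Q_def quad_model_def mnorm_def)

lemma v_in: "k < K \<Longrightarrow> v t k w \<in> C"
  using v_argmin[OF t _ w] by (auto simp: is_arg_min_linorder)

lemma v_le: "k < K \<Longrightarrow> u \<in> C \<Longrightarrow> grad (Q t w) (y t k w) \<bullet> v t k w \<le> grad (Q t w) (y t k w) \<bullet> u"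
  using v_argmin[OF t _ w, of k] by (auto simp: is_arg_min_linorder)

text \<open>The model value is compared with an arbitrary step \<open>r\<close> in the allowed
  range: \<open>r = \<gamma> t\<close> is used for the first inner step, \<open>r = 0\<close> for
  all later ones.\<close>

lemma inner_step:
  assumes k: "k < K" and yC: "y t k w \<in> C"
  shows "y t (Suc k) w \<in> C"
    and "norm (y t (Suc k) w - y t k w) \<le> \<gamma> t * Dc"
    and "0 \<le> r \<Longrightarrow> r \<le> \<gamma> t \<Longrightarrow>
      Q t w (y t (Suc k) w) \<le> Q t w (y t k w + r *\<^sub>R (v t k w - y t k w))"
proof -
  let ?y = "y t k w" and ?v = "v t k w"
  define a where "a = grad (Q t w) ?y \<bullet> (?y - ?v)"
  define c where "c = (mnorm (H t w) (?y - ?v))\<^sup>2 / \<eta> t"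
  define s where "s = min (a / c) (\<gamma> t)"
  have g01: "0 \<le> \<gamma> t" "\<gamma> t \<le> 1" using gamma[of t] by auto
  \<comment> \<open>The point \<open>?y\<close> lies in \<open>C\<close>, hence competes with the
    minimizer \<open>?v\<close>; this keeps the step size nonnegative.\<close>
  have a0: "0 \<le> a" using v_le[OF k yC] by (simp add: a_def inner_diff_right)
  have c0: "0 \<le> c" using eta_pos[of t] by (simp add: c_def)
  have s01: "0 \<le> s" "s \<le> \<gamma> t" using a0 c0 g01 by (auto simp: s_def)
  have cpos: "0 < c" if "?v \<noteq> ?y"
  proof -
    have "0 < lm t * (norm (?y - ?v))\<^sup>2" using that lm_pos by simp
    also have "\<dots> \<le> (mnorm (H t w) (?y - ?v))\<^sup>2" by (rule mnorm_H)
    finally show ?thesis using eta_pos[of t] by (simp add: c_def)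
  qed
  \<comment> \<open>The case \<open>?v = ?y\<close> is covered too: the direction is then zero,
    whatever \<open>s\<close> is.\<close>
  have ys: "y t (Suc k) w = ?y + s *\<^sub>R (?v - ?y)"
    unfolding y_Suc[OF t k w] by (auto simp: s_def a_def c_def mult.commute)
  have "(1 - s) *\<^sub>R ?y + s *\<^sub>R ?v \<in> C"
    using C_convex yC v_in[OF k] s01 g01 by (simp add: convex_alt)
  then show "y t (Suc k) w \<in> C" by (simp add: ys algebra_simps)
  show "norm (y t (Suc k) w - ?y) \<le> \<gamma> t * Dc"
    using s01 dist_le_diameter[OF v_in[OF k] yC] by (auto simp: ys intro: mult_mono)
  assume r: "0 \<le> r" "r \<le> \<gamma> t"
  show "Q t w (y t (Suc k) w) \<le> Q t w (?y + r *\<^sub>R (?v - ?y))"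
  proof (cases "?v = ?y")
    case False
    have mn: "(mnorm (H t w) (?v - ?y))\<^sup>2 = (mnorm (H t w) (?y - ?v))\<^sup>2"
      using matrix_vector_mult_scaleR[of "H t w" "-1" "?y - ?v"] by (simp add: mnorm_def flip: inner_minus_left)
    have Qs: "Q t w (?y + s *\<^sub>R (?v - ?y)) = Q t w ?y - s * a + s\<^sup>2 / 2 * c" for s
      unfolding Q_step mn by (simp add: a_def c_def inner_diff_right algebra_simps)
    show ?thesis
      unfolding ys Qs s_def using clipped_step_optimal[OF cpos[OF False] r, of a] by simp
  qed (simp add: ys)
qed

lemma y_in_if: "x t w \<in> C \<Longrightarrow> k \<le> K \<Longrightarrow> y t k w \<in> C"
proof (induction k)
  case 0 then show ?case using y_0[OF t w] by simp
next
  case (Suc k) then show ?case by (intro inner_step(1)) auto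
qed

end

lemma x_in: "t \<le> T \<Longrightarrow> w \<in> space M \<Longrightarrow> x t w \<in> C"
proof (induction t)
  case 0 then show ?case by (simp add: x_0 x0_in)
next
  case (Suc t) then show ?case by (simp add: x_Suc y_in_if)
qed

lemma y_in: "t < T \<Longrightarrow> w \<in> space M \<Longrightarrow> k \<le> K \<Longrightarrow> y t k w \<in> C"
  by (simp add: y_in_if x_in)

lemma norm_y_diff_le:
  assumes "t < T" "w \<in> space M"
  shows "k \<le> K \<Longrightarrow> norm (y t k w - x t w) \<le> real k * (\<gamma> t * Dc)"
proof (induction k)
  case 0 then show ?case using y_0[OF assms] by simp
next
  case (Suc k)
  have "norm (y t (Suc k) w - x t w) \<le> norm (y t (Suc k) w - y t k w) + norm (y t k w - x t w)"
    using norm_triangle_ineq[of "y t (Suc k) w - y t k w" "y t k w - x t w"] by simp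
  also have "\<dots> \<le> \<gamma> t * Dc + real k * (\<gamma> t * Dc)"
    using Suc assms by (intro add_mono inner_step(2) Suc.IH y_in) auto
  finally show ?case by (simp add: algebra_simps)
qed

lemma Q_y_le:
  assumes "t < T" "w \<in> space M"
  shows "Suc k \<le> K \<Longrightarrow> Q t w (y t (Suc k) w) \<le> Q t w (x t w + \<gamma> t *\<^sub>R (v t 0 w - x t w))"
proof (induction k)
  case 0
  then show ?case
    using inner_step(3)[OF assms, of 0 "\<gamma> t"] y_0[OF assms] x_in[of t w] gamma[of t] assms by simp
next
  case (Suc k)
  \<comment> \<open>Standing still, \<open>r = 0\<close>, is an admissible comparison, so the gain
    of the first step is never lost.\<close>
  have "Q t w (y t (Suc (Suc k)) w) \<le> Q t w (y t (Suc k) w + 0 *\<^sub>R (v t (Suc k) w - y t (Suc k) w))"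
    using Suc assms gamma[of t] by (intro inner_step(3) y_in) auto
  then show ?case using Suc by simp
qed

text \<open>In \<open>K + 1\<close>, the \<open>K\<close> comes from testing the sampling error
  against the total displacement of \<open>K\<close> inner steps, each of length at most
  \<open>\<gamma> t * Dc\<close>; the 1 comes from exchanging the sampled gradient for the true one
  in the direction of the gap maximizer \<open>u\<close>.\<close>

lemma one_step:
  assumes t: "t < T" and w: "w \<in> space M" and eta: "\<eta> t = lm t / Lc"
  shows "\<gamma> t * fw_gap C favg (x t w) \<le> favg (x t w) - favg (x (Suc t) w)
     + (real K + 1) * \<gamma> t * Dc * norm (err t w) + (\<gamma> t)\<^sup>2 * (Lc * Dc\<^sup>2 * (lp 0 / lm 0) / 2)"
proof -
  let ?x = "x t w" and ?x' = "x (Suc t) w" and ?v = "v t 0 w"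
  have xC: "?x \<in> C" and x'C: "?x' \<in> C" using x_in[of t w] x_in[of "Suc t" w] t w by auto
  have K0: "0 < K" using K_pos by simp
  have vC: "?v \<in> C" using v_in[OF t w K0] .
  have g0: "0 \<le> \<gamma> t" using gamma[of t] by auto
  obtain u where u: "u \<in> C" "fw_gap C favg ?x = grad favg ?x \<bullet> (?x - u)"
    by (rule fw_gap_attained)
  have move: "norm (?x' - ?x) \<le> real K * (\<gamma> t * Dc)"
    using norm_y_diff_le[OF t w, of K] x_Suc[OF t w] by simp
  \<comment> \<open>The learning rate is chosen for this step: \<open>Lc = lm t / \<eta> t\<close>,
    so the smoothness term is dominated by the quadratic term of the model, as \<open>lm t\<close>
    bounds the metric from below.\<close>
  have "Lc / 2 * (norm (?x' - ?x))\<^sup>2 = lm t * (norm (?x' - ?x))\<^sup>2 / (2 * \<eta> t)"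
    using lm_pos[of t] L_pos by (simp add: eta field_simps)
  also have "\<dots> \<le> (mnorm (H t w) (?x' - ?x))\<^sup>2 / (2 * \<eta> t)"
    using mnorm_H(2)[OF t w] eta_pos[of t] by (intro divide_right_mono) auto
  finally have "favg ?x' \<le> favg ?x + grad favg ?x \<bullet> (?x' - ?x) + (mnorm (H t w) (?x' - ?x))\<^sup>2 / (2 * \<eta> t)"
    using avg_descent[OF xC x'C] by simp
  also have "\<dots> = Q t w ?x' + - (err t w \<bullet> (?x' - ?x))"
    by (simp add: Q_def quad_model_def inner_diff_left)
  also have "- (err t w \<bullet> (?x' - ?x)) \<le> norm (err t w) * (real K * (\<gamma> t * Dc))"
    using norm_cauchy_schwarz[of "- err t w" "?x' - ?x"] move
    by (smt (verit) inner_minus_left norm_minus_cancel mult_left_mono norm_ge_zero)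
  finally have 1: "favg ?x' \<le> Q t w ?x' + norm (err t w) * (real K * (\<gamma> t * Dc))" by simp
  have "Q t w ?x' \<le> Q t w (?x + \<gamma> t *\<^sub>R (?v - ?x))"
    using Q_y_le[OF t w, of "K - 1"] K0 x_Suc[OF t w] by simp
  also have "\<dots> = favg ?x + \<gamma> t * (sgrad t w \<bullet> (?v - ?x))
      + (\<gamma> t)\<^sup>2 / 2 * ((mnorm (H t w) (?v - ?x))\<^sup>2 / \<eta> t)"
    unfolding Q_step[OF t w] Q_at_x[OF t w] grad_Q[OF t w] by simp
  finally have 2: "Q t w ?x' \<le> favg ?x + \<gamma> t * (sgrad t w \<bullet> (?v - ?x))
      + (\<gamma> t)\<^sup>2 / 2 * ((mnorm (H t w) (?v - ?x))\<^sup>2 / \<eta> t)" .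
  \<comment> \<open>The inner loop starts at \<open>?x\<close>, where the model gradient is just the
    sampled gradient; \<open>?v\<close> minimizes it over \<open>C\<close>, and \<open>u\<close> is
    a competitor.\<close>
  have "sgrad t w \<bullet> ?v \<le> sgrad t w \<bullet> u"
    using v_le[OF t w K0 u(1)] y_0[OF t w] by (simp add: grad_Q[OF t w])
  then have "sgrad t w \<bullet> (?v - ?x) \<le> sgrad t w \<bullet> (u - ?x)" by (simp add: inner_diff_right)
  also have "\<dots> = err t w \<bullet> (u - ?x) - fw_gap C favg ?x"
    by (simp add: u(2) inner_diff_left inner_diff_right)
  also have "err t w \<bullet> (u - ?x) \<le> norm (err t w) * Dc"
    using norm_cauchy_schwarz[of "err t w" "u - ?x"] dist_le_diameter[OF u(1) xC]
    by (meson mult_left_mono norm_ge_zero order_trans)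
  finally have 3: "\<gamma> t * (sgrad t w \<bullet> (?v - ?x)) \<le> \<gamma> t * (norm (err t w) * Dc - fw_gap C favg ?x)"
    using g0 by (intro mult_left_mono) auto
  \<comment> \<open>Any diagonal entry of \<open>H t w\<close> witnesses this;
    \<open>undefined\<close> merely names some index.\<close>
  have "0 \<le> lp t"
    using H_bounds[OF t w, of undefined] lm_pos[of t] by auto
  have "(mnorm (H t w) (?v - ?x))\<^sup>2 \<le> lp t * (norm (?v - ?x))\<^sup>2"
    by (rule mnorm_H(3)[OF t w])
  also have "\<dots> \<le> lp t * Dc\<^sup>2"
    using dist_le_diameter[OF vC xC] \<open>0 \<le> lp t\<close> by (intro mult_left_mono power_mono) auto
  finally have "(mnorm (H t w) (?v - ?x))\<^sup>2 / \<eta> t \<le> lp t * Dc\<^sup>2 / \<eta> t"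
    using eta_pos[of t] by (intro divide_right_mono) auto
  also have "\<dots> = Lc * Dc\<^sup>2 * (lp t / lm t)" by (simp add: eta)
  also have "\<dots> \<le> Lc * Dc\<^sup>2 * (lp 0 / lm 0)"
    using L_pos by (intro mult_left_mono lp_lm_ratio) auto
  finally have 4: "(\<gamma> t)\<^sup>2 / 2 * ((mnorm (H t w) (?v - ?x))\<^sup>2 / \<eta> t)
      \<le> (\<gamma> t)\<^sup>2 / 2 * (Lc * Dc\<^sup>2 * (lp 0 / lm 0))"
    by (intro mult_left_mono) auto
  show ?thesis using 1 2 3 4 by (simp add: algebra_simps)
qed

end

section \<open>Independence and the sampling error\<close>

lemma borel_measurable_matrix_vector_mult:
  fixes A :: "'w \<Rightarrow> real ^ 'n ^ 'n" and d :: "'w \<Rightarrow> real ^ 'n"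
  assumes [measurable]: "A \<in> borel_measurable N" "d \<in> borel_measurable N"
  shows "(\<lambda>w. A w *v d w) \<in> borel_measurable N"
proof (rule borel_measurable_continuous_Pair[OF assms])
  show "continuous_on UNIV (\<lambda>z :: (real ^ 'n ^ 'n) \<times> (real ^ 'n). fst z *v snd z)"
    unfolding matrix_vector_mult_def by (intro continuous_intros)
qed

lemma inner_sum_sum: "(\<Sum>i\<in>A. g i) \<bullet> (\<Sum>j\<in>B. h j) = (\<Sum>i\<in>A. \<Sum>j\<in>B. g i \<bullet> h j)"
  by (simp only: inner_sum_left) (simp only: inner_sum_right)

context prob_space
begin

text \<open>The sigma-algebras generated by the two random variables lie inside \<open>N'\<close>
  and \<open>N\<close>, so they inherit independence. This form gives access to the product rule for
  expectations.\<close>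

lemma indep_var_indicator:
  fixes Z :: "'a \<Rightarrow> real"
  assumes indep: "indep_set (sets N) (sets N')"
    and space: "space N = space M" "space N' = space M"
    and A: "A \<in> sets N'" and Z: "Z \<in> borel_measurable N"
  shows "indep_var borel (indicat_real A) borel Z"
proof -
  have sub: "sets N \<subseteq> events" "sets N' \<subseteq> events"
    using indep_setD_ev1[OF indep] indep_setD_ev2[OF indep] by auto
  have I: "indicat_real A \<in> borel_measurable N'" using A by simp
  have sig: "sigma_sets (space M) {Z -` B \<inter> space M |B. B \<in> sets borel} \<subseteq> sets N"
    using measurable_sets[OF Z] unfolding space(1)[symmetric]
    by (intro sets.sigma_sets_subset) auto
  have sig': "sigma_sets (space M) {indicat_real A -` B \<inter> space M |B. B \<in> sets borel} \<subseteq> sets N'"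
    using measurable_sets[OF I] unfolding space(2)[symmetric]
    by (intro sets.sigma_sets_subset) auto
  have rv: "random_variable borel (indicat_real A)" "random_variable borel Z"
    using I Z sub space by (auto intro: measurable_from_subalg simp: subalgebra_def)
  moreover have "prob (B' \<inter> B) = prob B' * prob B" if "B \<in> sets N" "B' \<in> sets N'" for B B'
    using indep_setD[OF indep that] by (simp add: Int_commute mult.commute)
  ultimately show ?thesis
    unfolding indep_var_eq indep_sets2_eq using sig sig' sub by (intro conjI ballI) (blast+)
qed

text \<open>Freezing a finitely valued \<open>I\<close> independent of \<open>N\<close>: write the
  integrand as a sum of \<open>\<phi> s\<close> times the indicator of \<open>I = s\<close>, and
  factor each expectation. It takes the place of conditioning, both for the sampled batch and for
  the random output index.\<close>

lemma expectation_indep_discrete: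
  fixes \<phi> :: "'i \<Rightarrow> 'a \<Rightarrow> real"
  assumes indep: "indep_set (sets N) (sets N')"
    and space: "space N = space M" "space N' = space M"
    and S: "finite S" "\<And>w. w \<in> space M \<Longrightarrow> I w \<in> S"
    and I: "\<And>s. s \<in> S \<Longrightarrow> {w \<in> space M. I w = s} \<in> sets N'"
    and \<phi>: "\<And>s. s \<in> S \<Longrightarrow> \<phi> s \<in> borel_measurable N" "\<And>s. s \<in> S \<Longrightarrow> integrable M (\<phi> s)"
  shows "integrable M (\<lambda>w. \<phi> (I w) w)"
    and "expectation (\<lambda>w. \<phi> (I w) w) = (\<Sum>s\<in>S. prob {w \<in> space M. I w = s} * expectation (\<phi> s))"
proof -
  let ?A = "\<lambda>s. {w \<in> space M. I w = s}"
  have eq: "\<phi> (I w) w = (\<Sum>s\<in>S. indicat_real (?A s) w * \<phi> s w)" if "w \<in> space M" for w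
  proof -
    have "(\<Sum>s\<in>S. indicat_real (?A s) w * \<phi> s w) = (\<Sum>s\<in>S. if s = I w then \<phi> (I w) w else 0)"
      using that by (intro sum.cong) (auto simp: indicator_def)
    then show ?thesis using S that by simp
  qed
  have ev: "?A s \<in> events" if "s \<in> S" for s
    using I[OF that] indep_setD_ev2[OF indep] by auto
  have iv: "indep_var borel (indicat_real (?A s)) borel (\<phi> s)" if "s \<in> S" for s
    using that by (intro indep_var_indicator[OF indep space] I \<phi>)
  have int1: "integrable M (indicat_real (?A s))" if "s \<in> S" for s
    using ev[OF that] by (simp add: less_top[symmetric])
  have int: "integrable M (\<lambda>w. indicat_real (?A s) w * \<phi> s w)" if "s \<in> S" for s
    by (rule indep_var_integrable[OF iv int1 \<phi>(2)]) fact+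
  have "integrable M (\<lambda>w. \<Sum>s\<in>S. indicat_real (?A s) w * \<phi> s w)"
    using int by (rule Bochner_Integration.integrable_sum)
  then show "integrable M (\<lambda>w. \<phi> (I w) w)"
    using eq by (subst Bochner_Integration.integrable_cong[OF refl]) auto
  have "expectation (\<lambda>w. \<phi> (I w) w) = expectation (\<lambda>w. \<Sum>s\<in>S. indicat_real (?A s) w * \<phi> s w)"
    using eq by (intro Bochner_Integration.integral_cong) auto
  also have "\<dots> = (\<Sum>s\<in>S. expectation (\<lambda>w. indicat_real (?A s) w * \<phi> s w))"
    using int by (rule Bochner_Integration.integral_sum)
  also have "\<dots> = (\<Sum>s\<in>S. expectation (indicat_real (?A s)) * expectation (\<phi> s))"
    by (intro sum.cong refl indep_var_lebesgue_integral iv int1 \<phi>(2))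
  also have "\<dots> = (\<Sum>s\<in>S. prob (?A s) * expectation (\<phi> s))"
    using ev by (intro sum.cong) (auto simp: sets.Int_space_eq2)
  finally show "expectation (\<lambda>w. \<phi> (I w) w) = (\<Sum>s\<in>S. prob (?A s) * expectation (\<phi> s))" .
qed

lemma prob_uniform_eq:
  assumes "finite S" "s \<in> S" and Z: "random_variable (count_space S) Z"
    and uniform: "distr M (count_space S) Z = uniform_count_measure S"
  shows "prob {w \<in> space M. Z w = s} = 1 / card S"
proof -
  have "prob {w \<in> space M. Z w = s} = measure (distr M (count_space S) Z) {s}"
    using assms(2) by (subst measure_distr[OF Z]) (simp_all add: vimage_def Int_def conj_commute)
  then show ?thesis
    using assms by (simp add: measure_uniform_count_measure)
qed

end

section \<open>Measurability and integrability along the run\<close>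

context adasfw
begin

lemma subalgebra_F: "subalgebra M (F t)"
  using F_sub space_F by (simp add: subalgebra_def)

lemma measurable_F_mono: "s \<le> t \<Longrightarrow> h \<in> F s \<rightarrow>\<^sub>M N \<Longrightarrow> h \<in> F t \<rightarrow>\<^sub>M N"
  using space_F sets_F_mono by (intro measurable_from_subalg[of "F t" "F s"]) (auto simp: subalgebra_def)

lemma measurable_F_imp: "h \<in> F t \<rightarrow>\<^sub>M N \<Longrightarrow> h \<in> M \<rightarrow>\<^sub>M N"
  by (rule measurable_from_subalg[OF subalgebra_F])

lemma idx_in: "t < T \<Longrightarrow> j < b t \<Longrightarrow> w \<in> space M \<Longrightarrow> idx t j w \<in> {1..m}"
  using measurable_space[OF idx_measurable, of t j w] space_F by simp

lemma grad_component_measurable [measurable]: "i \<in> {1..m} \<Longrightarrow> grad (f i) \<in> borel_measurable borel"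
  by (intro borel_measurable_continuous_onI continuous_on_grad_component)

lemma grad_avg_measurable [measurable]: "grad favg \<in> borel_measurable borel"
  by (intro borel_measurable_continuous_onI continuous_on_grad_avg)

lemma avg_measurable [measurable]: "favg \<in> borel_measurable borel"
  by (intro borel_measurable_continuous_onI continuous_on_avg)

lemma fw_gap_measurable [measurable]: "fw_gap C favg \<in> borel_measurable borel"
  by (intro borel_measurable_continuous_onI continuous_on_fw_gap)

lemma sgrad_measurable:
  assumes t: "t < T" and [measurable]: "x t \<in> borel_measurable (F (Suc t))"
  shows "sgrad t \<in> borel_measurable (F (Suc t))"
proof -
  \<comment> \<open>The component itself is random, so measurability is checked separately for each
    of its finitely many values.\<close>
  have "(\<lambda>w. grad (f (idx t j w)) (x t w)) \<in> borel_measurable (F (Suc t))" if "j < b t" for j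
  proof (rule measurable_compose_countable'[OF _ idx_measurable[OF t that]])
    fix i assume "i \<in> {1..m}"
    then show "(\<lambda>w. grad (f i) (x t w)) \<in> borel_measurable (F (Suc t))" by measurable
  qed simp
  then show ?thesis
    unfolding sgrad_def
    by (intro borel_measurable_scaleR borel_measurable_const borel_measurable_sum) auto
qed

lemma y_measurable:
  assumes t: "t < T" and x: "x t \<in> borel_measurable (F (Suc t))"
  shows "k \<le> K \<Longrightarrow> y t k \<in> borel_measurable (F (Suc t))"
proof (induction k)
  case 0
  show ?case
    using x by (rule measurable_cong[THEN iffD1, rotated]) (simp add: y_0[OF t] space_F)
next
  case (Suc k)
  then have k: "k < K" and yk [measurable]: "y t k \<in> borel_measurable (F (Suc t))" by auto
  note [measurable] = x v_measurable[OF t k] sgrad_measurable[OF t x] H_measurable[OF t]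
    borel_measurable_matrix_vector_mult
  \<comment> \<open>The case \<open>v t k w = y t k w\<close> needs no branch: there the step size \<open>0 / 0 = 0\<close> multiplies \<open>0\<close>.\<close>
  have "(\<lambda>w. y t k w + min (\<eta> t * ((sgrad t w + (1 / \<eta> t) *\<^sub>R (H t w *v (y t k w - x t w))) \<bullet>
        (y t k w - v t k w)) / ((y t k w - v t k w) \<bullet> (H t w *v (y t k w - v t k w)))) (\<gamma> t)
        *\<^sub>R (v t k w - y t k w)) \<in> borel_measurable (F (Suc t))"
    by measurable
  then show ?case
  proof (rule measurable_cong[THEN iffD1, rotated])
    fix w assume "w \<in> space (F (Suc t))"
    then have w: "w \<in> space M" by (simp add: space_F)
    show "y t k w + min (\<eta> t * ((sgrad t w + (1 / \<eta> t) *\<^sub>R (H t w *v (y t k w - x t w))) \<bullet>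
        (y t k w - v t k w)) / ((y t k w - v t k w) \<bullet> (H t w *v (y t k w - v t k w)))) (\<gamma> t)
        *\<^sub>R (v t k w - y t k w) = y t (Suc k) w"
      using y_Suc[OF t k w] by (simp add: grad_Q[OF t w] mnorm_H(1)[OF t w])
  qed
qed

text \<open>The time index is essential: the batch of iteration \<open>t\<close> is independent of
  \<open>F t\<close>, hence of the point at which its gradients are evaluated.\<close>

lemma x_measurable: "t \<le> T \<Longrightarrow> x t \<in> borel_measurable (F t)"
proof (induction t)
  case 0
  have "(\<lambda>w. x0) \<in> borel_measurable (F 0)" by simp
  then show ?case
    by (rule measurable_cong[THEN iffD1, rotated]) (simp add: x_0 space_F)
next
  case (Suc t)
  then have "y t K \<in> borel_measurable (F (Suc t))"
    by (intro y_measurable measurable_F_mono[of t "Suc t" "x t"]) auto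
  then show ?case
    by (rule measurable_cong[THEN iffD1, rotated]) (use Suc in \<open>simp add: x_Suc space_F\<close>)
qed

lemma x_random [measurable]: "t \<le> T \<Longrightarrow> random_variable borel (x t)"
  by (rule measurable_F_imp[OF x_measurable])

lemma sgrad_random: "t < T \<Longrightarrow> random_variable borel (sgrad t)"
  by (intro measurable_F_imp[OF sgrad_measurable] measurable_F_mono[OF _ x_measurable]) auto

lemma integrable_gap: "t \<le> T \<Longrightarrow> integrable M (\<lambda>w. fw_gap C favg (x t w))"
  using fw_gap_bounds[OF x_in]
  by (intro integrable_const_bound[where B = "Gc * Dc"] AE_I2) (auto simp: abs_le_iff)

lemma integrable_avg:
  assumes "t \<le> T"
  shows "integrable M (\<lambda>w. favg (x t w))"
proof -
  have "bounded (favg ` C)"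
    by (intro compact_imp_bounded compact_continuous_image continuous_on_avg C_compact)
  then obtain B where "\<And>z. z \<in> C \<Longrightarrow> norm (favg z) \<le> B" by (auto simp: bounded_iff)
  then show ?thesis using x_in assms by (intro integrable_const_bound[where B = B] AE_I2) auto
qed

section \<open>Mean square error of the batch gradient\<close>

definition dev :: "nat \<Rightarrow> real ^ 'n \<Rightarrow> real ^ 'n" where
  "dev i z = grad (f i) z - grad favg z"

lemma dev_measurable [measurable]: "i \<in> {1..m} \<Longrightarrow> dev i \<in> borel_measurable borel"
  unfolding dev_def[abs_def] by measurable

lemma sum_dev: "(\<Sum>i = 1..m. dev i z) = 0"
  using m_pos by (simp add: dev_def sum_subtractf grad_avg sum_constant_scaleR del: sum_constant)

text \<open>A crude bound that serves integrability; the constant in the error estimate comes from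
  \<open>sum_norm_dev_le\<close>.\<close>

lemma norm_dev_le: "i \<in> {1..m} \<Longrightarrow> z \<in> C \<Longrightarrow> norm (dev i z) \<le> 2 * Gc"
  using norm_triangle_ineq4[of "grad (f i) z" "grad favg z"] norm_grad_component_le norm_grad_avg_le[of z]
  by (fastforce simp: dev_def)

text \<open>A variance is at most the second moment. The squares are expanded so that the cross term
  contains \<open>dev\<close> itself and vanishes on summation by \<open>sum_dev\<close>; the
  squared norm of the mean is then dropped.\<close>

lemma sum_norm_dev_le:
  assumes "z \<in> C"
  shows "(\<Sum>i = 1..m. (norm (dev i z))\<^sup>2) \<le> real m * Gc\<^sup>2"
proof -
  let ?g = "grad favg z"
  have "(norm (dev i z))\<^sup>2 = (norm (grad (f i) z))\<^sup>2 - (norm ?g)\<^sup>2 - 2 * (dev i z \<bullet> ?g)" for i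
    unfolding power2_norm_eq_inner by (simp add: dev_def inner_diff_left inner_diff_right inner_commute)
  then have "(\<Sum>i = 1..m. (norm (dev i z))\<^sup>2)
      = (\<Sum>i = 1..m. (norm (grad (f i) z))\<^sup>2) - real m * (norm ?g)\<^sup>2 - 2 * ((\<Sum>i = 1..m. dev i z) \<bullet> ?g)"
    by (simp add: sum_subtractf inner_sum_left sum_distrib_left)
  also have "\<dots> \<le> (\<Sum>i = 1..m. (norm (grad (f i) z))\<^sup>2)"
    unfolding sum_dev by simp
  also have "\<dots> \<le> (\<Sum>i = 1..m. Gc\<^sup>2)"
    using assms by (intro sum_mono power_mono norm_grad_component_le) auto
  finally show ?thesis by simp
qed

context
  fixes t
  assumes t: "t < T"
begin

abbreviation "batch_algebra \<equiv>
  vimage_algebra (space M) (\<lambda>w. \<lambda>j\<in>{..<b t}. idx t j w) (PiM {..<b t} (\<lambda>_. count_space {1..m}))"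

lemma err_eq: "w \<in> space M \<Longrightarrow> err t w = (1 / real (b t)) *\<^sub>R (\<Sum>j<b t. dev (idx t j w) (x t w))"
  using b_pos[of t] by (simp add: sgrad_def dev_def sum_subtractf scaleR_diff_right sum_constant_scaleR del: sum_constant)

text \<open>Freshness concerns the batch as one element of a product space, so events about two
  indices are pulled back through two coordinates. The case \<open>j = k\<close> is included and
  provides the events of a single index.\<close>

lemma batch_event:
  assumes j: "j < b t" and k: "k < b t"
  shows "{w \<in> space M. idx t j w = p \<and> idx t k w = q} \<in> sets batch_algebra"
proof -
  let ?P = "PiM {..<b t} (\<lambda>_. count_space {1..m})"
  have [measurable]: "(\<lambda>g. g j) \<in> ?P \<rightarrow>\<^sub>M count_space {1..m}" "(\<lambda>g. g k) \<in> ?P \<rightarrow>\<^sub>M count_space {1..m}"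
    using j k by (auto intro: measurable_component_singleton)
  have "{g \<in> space ?P. g j = p \<and> g k = q} \<in> sets ?P" by measurable
  then have "(\<lambda>w. \<lambda>j\<in>{..<b t}. idx t j w) -` {g \<in> space ?P. g j = p \<and> g k = q} \<inter> space M \<in> sets batch_algebra"
    by (rule in_vimage_algebra)
  also have "(\<lambda>w. \<lambda>j\<in>{..<b t}. idx t j w) -` {g \<in> space ?P. g j = p \<and> g k = q} \<inter> space M
      = {w \<in> space M. idx t j w = p \<and> idx t k w = q}"
    using j k idx_in[OF t] by (auto simp: space_PiM)
  finally show ?thesis .
qed

lemma prob_idx: "j < b t \<Longrightarrow> p \<in> {1..m} \<Longrightarrow> prob {w \<in> space M. idx t j w = p} = 1 / real m"
  using prob_uniform_eq[of "{1..m}" p "idx t j"] idx_uniform[OF t, of j]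
    measurable_F_imp[OF idx_measurable[OF t]] by simp

lemma prob_idx_pair:
  assumes j: "j < b t" and k: "k < b t" and "j \<noteq> k" and p: "p \<in> {1..m}" and q: "q \<in> {1..m}"
  shows "prob {w \<in> space M. (idx t j w, idx t k w) = (p, q)} = 1 / (real m)\<^sup>2"
proof -
  have "prob (\<Inter>i\<in>{j, k}. idx t i -` (if i = j then {p} else {q}) \<inter> space M)
      = (\<Prod>i\<in>{j, k}. prob (idx t i -` (if i = j then {p} else {q}) \<inter> space M))"
    using j k p q by (intro indep_varsD[OF idx_indep[OF t]]) auto
  also have "\<dots> = prob {w \<in> space M. idx t j w = p} * prob {w \<in> space M. idx t k w = q}"
    using \<open>j \<noteq> k\<close> by (auto intro!: arg_cong2[of _ _ _ _ "(*)"] arg_cong[of _ _ prob])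
  also have "\<dots> = 1 / (real m)\<^sup>2"
    using assms by (simp add: prob_idx power2_eq_square)
  also have "(\<Inter>i\<in>{j, k}. idx t i -` (if i = j then {p} else {q}) \<inter> space M)
      = {w \<in> space M. (idx t j w, idx t k w) = (p, q)}"
    using \<open>j \<noteq> k\<close> by auto
  finally show ?thesis .
qed

lemma dev_inner_integrable:
  assumes "p \<in> {1..m}" "q \<in> {1..m}"
  shows "(\<lambda>w. dev p (x t w) \<bullet> dev q (x t w)) \<in> borel_measurable (F t)"
    and "integrable M (\<lambda>w. dev p (x t w) \<bullet> dev q (x t w))"
proof -
  note [measurable] = x_measurable[OF less_imp_le[OF t]]
  show meas: "(\<lambda>w. dev p (x t w) \<bullet> dev q (x t w)) \<in> borel_measurable (F t)"
    using assms by measurable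
  have "\<bar>dev p (x t w) \<bullet> dev q (x t w)\<bar> \<le> (2 * Gc) * (2 * Gc)" if "w \<in> space M" for w
    using norm_dev_le[OF assms(1) x_in, of t w] norm_dev_le[OF assms(2) x_in, of t w] t that G_pos
    by (intro order_trans[OF Cauchy_Schwarz_ineq2] mult_mono) auto
  then show "integrable M (\<lambda>w. dev p (x t w) \<bullet> dev q (x t w))"
    using measurable_F_imp[OF meas] by (intro integrable_const_bound[where B = "(2 * Gc) * (2 * Gc)"] AE_I2) auto
qed

text \<open>Both indices are frozen, since the batch is independent of \<open>x t\<close>. For
  \<open>j \<noteq> k\<close> the pair is uniform and the double sum factors into an inner product
  of two sums that are zero; for \<open>j = k\<close> the variance bound applies.\<close>

lemma dev_cross:
  assumes j: "j < b t" and k: "k < b t"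
  shows "integrable M (\<lambda>w. dev (idx t j w) (x t w) \<bullet> dev (idx t k w) (x t w))"
    and "expectation (\<lambda>w. dev (idx t j w) (x t w) \<bullet> dev (idx t k w) (x t w)) \<le> (if j = k then Gc\<^sup>2 else 0)"
proof -
  let ?\<phi> = "\<lambda>(p, q) w. dev p (x t w) \<bullet> dev q (x t w)"
  let ?S = "{1..m} \<times> {1..m}"
  note disc = expectation_indep_discrete[OF idx_fresh[OF t] space_F space_vimage_algebra,
      where S = ?S and \<phi> = ?\<phi> and I = "\<lambda>w. (idx t j w, idx t k w)"]
  have int: "integrable M (\<lambda>w. ?\<phi> (idx t j w, idx t k w) w)"
    and exp: "expectation (\<lambda>w. ?\<phi> (idx t j w, idx t k w) w)
      = (\<Sum>s\<in>?S. prob {w \<in> space M. (idx t j w, idx t k w) = s} * expectation (?\<phi> s))"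
    using batch_event[OF j k] idx_in[OF t] j k dev_inner_integrable by (intro disc; force)+
  show "integrable M (\<lambda>w. dev (idx t j w) (x t w) \<bullet> dev (idx t k w) (x t w))"
    using int by simp
  show "expectation (\<lambda>w. dev (idx t j w) (x t w) \<bullet> dev (idx t k w) (x t w)) \<le> (if j = k then Gc\<^sup>2 else 0)"
  proof (cases "j = k")
    case False
    have "expectation (\<lambda>w. ?\<phi> (idx t j w, idx t k w) w) = (\<Sum>s\<in>?S. 1 / (real m)\<^sup>2 * expectation (?\<phi> s))"
      unfolding exp using prob_idx_pair[OF j k False]
      by (intro sum.cong refl arg_cong2[of _ _ _ _ "(*)"]) auto
    also have "\<dots> = 1 / (real m)\<^sup>2 * expectation (\<lambda>w. \<Sum>s\<in>?S. ?\<phi> s w)"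
      using dev_inner_integrable
      by (subst Bochner_Integration.integral_sum) (auto simp: sum_distrib_left)
    also have "(\<lambda>w. \<Sum>s\<in>?S. ?\<phi> s w) = (\<lambda>w. (\<Sum>p = 1..m. dev p (x t w)) \<bullet> (\<Sum>q = 1..m. dev q (x t w)))"
      by (simp add: sum.cartesian_product inner_sum_sum split_def)
    also have "\<dots> = (\<lambda>w. 0)" by (simp only: sum_dev inner_zero_left)
    finally show ?thesis using False by simp
  next
    case True
    \<comment> \<open>A repeated index is not uniform on \<open>?S\<close>, so here a single index
      is frozen instead.\<close>
    have event: "{w \<in> space M. idx t j w = p} \<in> sets batch_algebra" for p
      using batch_event[OF j j, of p p] by simp
    note disc1 = expectation_indep_discrete(2)[OF idx_fresh[OF t] space_F space_vimage_algebra,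
      where S = "{1..m}" and \<phi> = "\<lambda>p w. dev p (x t w) \<bullet> dev p (x t w)" and I = "idx t j"]
    have "expectation (\<lambda>w. dev (idx t j w) (x t w) \<bullet> dev (idx t j w) (x t w))
      = (\<Sum>p = 1..m. prob {w \<in> space M. idx t j w = p} * expectation (\<lambda>w. dev p (x t w) \<bullet> dev p (x t w)))"
      using idx_in[OF t j] dev_inner_integrable by (intro disc1 event) auto
    also have "\<dots> = 1 / real m * expectation (\<lambda>w. \<Sum>p = 1..m. dev p (x t w) \<bullet> dev p (x t w))"
      using dev_inner_integrable prob_idx[OF j]
      by (subst Bochner_Integration.integral_sum) (auto simp: sum_distrib_left)
    also have "\<dots> \<le> 1 / real m * (real m * Gc\<^sup>2)"
      using dev_inner_integrable sum_norm_dev_le[OF x_in] t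
      by (intro mult_left_mono integral_le_const Bochner_Integration.integrable_sum AE_I2)
        (auto simp: power2_norm_eq_inner)
    finally show ?thesis using True m_pos by simp
  qed
qed

text \<open>Of the \<open>(b t)\<^sup>2\<close> products in the expanded square, only the
  \<open>b t\<close> diagonal ones can have positive expectation; against the squared prefactor this
  leaves \<open>1 / b t\<close>.\<close>

lemma err_second_moment:
  shows "integrable M (\<lambda>w. (norm (err t w))\<^sup>2)"
    and "expectation (\<lambda>w. (norm (err t w))\<^sup>2) \<le> Gc\<^sup>2 / real (b t)"
proof -
  let ?c = "\<lambda>j k w. dev (idx t j w) (x t w) \<bullet> dev (idx t k w) (x t w)"
  have eq: "(norm (err t w))\<^sup>2 = (1 / (real (b t))\<^sup>2) * (\<Sum>j<b t. \<Sum>k<b t. ?c j k w)" if "w \<in> space M" for w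
    unfolding err_eq[OF that] power2_norm_eq_inner
    by (simp add: inner_sum_sum power2_eq_square)
  have int: "integrable M (\<lambda>w. (1 / (real (b t))\<^sup>2) * (\<Sum>j<b t. \<Sum>k<b t. ?c j k w))"
    using dev_cross(1) by (intro integrable_mult_right Bochner_Integration.integrable_sum) auto
  then show "integrable M (\<lambda>w. (norm (err t w))\<^sup>2)"
    using eq by (subst Bochner_Integration.integrable_cong[OF refl]) auto
  have "expectation (\<lambda>w. (norm (err t w))\<^sup>2)
      = expectation (\<lambda>w. (1 / (real (b t))\<^sup>2) * (\<Sum>j<b t. \<Sum>k<b t. ?c j k w))"
    using eq by (intro Bochner_Integration.integral_cong) auto
  also have "\<dots> = (1 / (real (b t))\<^sup>2) * (\<Sum>j<b t. \<Sum>k<b t. expectation (?c j k))"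
  proof -
    have "expectation (\<lambda>w. \<Sum>j<b t. \<Sum>k<b t. ?c j k w) = (\<Sum>j<b t. expectation (\<lambda>w. \<Sum>k<b t. ?c j k w))"
      using dev_cross(1) by (intro Bochner_Integration.integral_sum Bochner_Integration.integrable_sum) auto
    also have "\<dots> = (\<Sum>j<b t. \<Sum>k<b t. expectation (?c j k))"
      using dev_cross(1) by (intro sum.cong refl Bochner_Integration.integral_sum) auto
    finally show ?thesis by (subst integral_mult_right_zero) simp
  qed
  also have "\<dots> \<le> (1 / (real (b t))\<^sup>2) * (\<Sum>j<b t. \<Sum>k<b t. if j = k then Gc\<^sup>2 else 0)"
    using dev_cross(2) by (intro mult_left_mono sum_mono) auto
  also have "\<dots> = Gc\<^sup>2 / real (b t)"
    using b_pos[of t] by (simp add: power2_eq_square)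
  finally show "expectation (\<lambda>w. (norm (err t w))\<^sup>2) \<le> Gc\<^sup>2 / real (b t)" .
qed

lemma err_first_moment:
  shows "integrable M (\<lambda>w. norm (err t w))"
    and "expectation (\<lambda>w. norm (err t w)) \<le> Gc / sqrt (real (b t))"
proof -
  \<comment> \<open>The bound on the root mean square error; at this value the two terms of the
    estimate below balance and return \<open>a\<close> itself.\<close>
  define a where "a = Gc / sqrt (real (b t))"
  have a: "0 < a" using G_pos b_pos[of t] by (simp add: a_def)
  have a2: "Gc\<^sup>2 / real (b t) = a\<^sup>2" by (simp add: a_def power_divide)
  \<comment> \<open>By AM-GM; integrated, this replaces Jensen's inequality for the square root.\<close>
  have le: "norm (err t w) \<le> ((norm (err t w))\<^sup>2 / a + a) / 2" for w
  proof -
    have "0 \<le> (norm (err t w) - a)\<^sup>2" by simp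
    then show ?thesis using a by (simp add: power2_eq_square field_simps)
  qed
  have int2: "integrable M (\<lambda>w. ((norm (err t w))\<^sup>2 / a + a) / 2)"
    using err_second_moment(1) by simp
  note [measurable] = sgrad_random[OF t] x_random[OF less_imp_le[OF t]]
  show int: "integrable M (\<lambda>w. norm (err t w))"
  proof (rule Bochner_Integration.integrable_bound[OF int2])
    show "AE w in M. norm (norm (err t w)) \<le> norm (((norm (err t w))\<^sup>2 / a + a) / 2)"
      using order_trans[OF le abs_ge_self] by simp
  qed measurable
  have "expectation (\<lambda>w. norm (err t w)) \<le> expectation (\<lambda>w. ((norm (err t w))\<^sup>2 / a + a) / 2)"
    by (intro integral_mono int int2 le)
  also have "\<dots> = (expectation (\<lambda>w. (norm (err t w))\<^sup>2) / a + a) / 2"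
    using err_second_moment(1) by (simp add: prob_space)
  also have "\<dots> \<le> (a\<^sup>2 / a + a) / 2"
    using err_second_moment(2) a unfolding a2 by (intro divide_right_mono add_right_mono) auto
  finally show "expectation (\<lambda>w. norm (err t w)) \<le> Gc / sqrt (real (b t))"
    using a by (simp add: a_def[symmetric] power2_eq_square)
qed

section \<open>Expected progress, telescoping and the random iterate\<close>

lemma one_step_expectation:
  assumes eta: "\<eta> t = lm t / Lc"
  shows "\<gamma> t * expectation (\<lambda>w. fw_gap C favg (x t w))
    \<le> expectation (\<lambda>w. favg (x t w)) - expectation (\<lambda>w. favg (x (Suc t) w))
     + (real K + 1) * \<gamma> t * Dc * (Gc / sqrt (real (b t))) + (\<gamma> t)\<^sup>2 * (Lc * Dc\<^sup>2 * (lp 0 / lm 0) / 2)"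
proof -
  note ints = integrable_gap[of t] integrable_avg[of t] integrable_avg[of "Suc t"] err_first_moment(1)
  have "\<gamma> t * expectation (\<lambda>w. fw_gap C favg (x t w)) = expectation (\<lambda>w. \<gamma> t * fw_gap C favg (x t w))"
    by simp
  also have "\<dots> \<le> expectation (\<lambda>w. favg (x t w) - favg (x (Suc t) w)
     + (real K + 1) * \<gamma> t * Dc * norm (err t w) + (\<gamma> t)\<^sup>2 * (Lc * Dc\<^sup>2 * (lp 0 / lm 0) / 2))"
    using ints t
    by (intro integral_mono one_step eta Bochner_Integration.integrable_add
        Bochner_Integration.integrable_diff integrable_mult_right integrable_const) auto
  also have "\<dots> = expectation (\<lambda>w. favg (x t w)) - expectation (\<lambda>w. favg (x (Suc t) w))
     + (real K + 1) * \<gamma> t * Dc * expectation (\<lambda>w. norm (err t w)) + (\<gamma> t)\<^sup>2 * (Lc * Dc\<^sup>2 * (lp 0 / lm 0) / 2)"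
    using ints t by (simp add: prob_space)
  also have "(real K + 1) * \<gamma> t * Dc * expectation (\<lambda>w. norm (err t w))
      \<le> (real K + 1) * \<gamma> t * Dc * (Gc / sqrt (real (b t)))"
    using gamma[of t] D_pos by (intro mult_left_mono err_first_moment(2)) auto
  finally show ?thesis by simp
qed

end

text \<open>Here \<open>\<delta>\<close> is the sampling error relative to \<open>Lc * Dc\<close>,
  and \<open>\<sigma>\<close> majorizes both \<open>\<gamma> s * \<delta> s\<close> and the square
  of \<open>\<gamma> s\<close>. One summation then serves both step-size schedules.\<close>

lemma sum_gap_le:
  assumes eta: "\<And>t. \<eta> t = lm t / Lc" and "n \<le> T"
    and batch: "\<And>s. s < n \<Longrightarrow> Gc / sqrt (real (b s)) \<le> Lc * Dc * \<delta> s"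
    and \<sigma>: "\<And>s. s < n \<Longrightarrow> \<gamma> s * \<delta> s \<le> \<sigma> s" "\<And>s. s < n \<Longrightarrow> (\<gamma> s)\<^sup>2 \<le> \<sigma> s"
  shows "(\<Sum>s<n. \<gamma> s * expectation (\<lambda>w. fw_gap C favg (x s w)))
    \<le> favg x0 - (INF z\<in>C. favg z) + Lc * Dc\<^sup>2 * (real K + 1 + (lp 0 / lm 0) / 2) * (\<Sum>s<n. \<sigma> s)"
proof -
  let ?\<kappa> = "lp 0 / lm 0" and ?E = "\<lambda>s. expectation (\<lambda>w. favg (x s w))"
  have kappa0: "0 \<le> ?\<kappa>" using lambda[of 0] by (intro divide_nonneg_nonneg) auto
  have "\<gamma> s * expectation (\<lambda>w. fw_gap C favg (x s w))
      \<le> ?E s - ?E (Suc s) + Lc * Dc\<^sup>2 * (real K + 1 + ?\<kappa> / 2) * \<sigma> s" if s: "s < n" for s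
  proof -
    have "(real K + 1) * \<gamma> s * Dc * (Gc / sqrt (real (b s))) \<le> (real K + 1) * \<gamma> s * Dc * (Lc * Dc * \<delta> s)"
      using gamma[of s] D_pos batch[OF s] by (intro mult_left_mono) auto
    also have "\<dots> = (Lc * Dc\<^sup>2 * (real K + 1)) * (\<gamma> s * \<delta> s)"
      by (simp add: power2_eq_square)
    also have "\<dots> \<le> (Lc * Dc\<^sup>2 * (real K + 1)) * \<sigma> s"
      using L_pos by (intro mult_left_mono \<sigma>(1) s) auto
    finally have 1: "(real K + 1) * \<gamma> s * Dc * (Gc / sqrt (real (b s))) \<le> (Lc * Dc\<^sup>2 * (real K + 1)) * \<sigma> s" .
    have 2: "(\<gamma> s)\<^sup>2 * (Lc * Dc\<^sup>2 * ?\<kappa> / 2) \<le> \<sigma> s * (Lc * Dc\<^sup>2 * ?\<kappa> / 2)"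
      using L_pos mult_nonneg_nonneg[OF _ kappa0, of "Lc * Dc\<^sup>2"]
      by (intro mult_right_mono \<sigma>(2) s) auto
    have "Lc * Dc\<^sup>2 * (real K + 1 + ?\<kappa> / 2) * \<sigma> s
        = (Lc * Dc\<^sup>2 * (real K + 1)) * \<sigma> s + \<sigma> s * (Lc * Dc\<^sup>2 * ?\<kappa> / 2)"
      by (simp add: algebra_simps)
    moreover have "s < T" using s \<open>n \<le> T\<close> by simp
    ultimately show ?thesis using one_step_expectation[OF _ eta, of s] 1 2 by linarith
  qed
  then have "(\<Sum>s<n. \<gamma> s * expectation (\<lambda>w. fw_gap C favg (x s w)))
      \<le> (\<Sum>s<n. ?E s - ?E (Suc s) + Lc * Dc\<^sup>2 * (real K + 1 + ?\<kappa> / 2) * \<sigma> s)"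
    by (intro sum_mono) auto
  also have "\<dots> = ?E 0 - ?E n + Lc * Dc\<^sup>2 * (real K + 1 + ?\<kappa> / 2) * (\<Sum>s<n. \<sigma> s)"
    using sum_lessThan_telescope'[of ?E n] by (simp add: sum.distrib sum_distrib_left)
  also have "?E 0 = favg x0"
    using Bochner_Integration.integral_cong[of M M "\<lambda>w. favg (x 0 w)" "\<lambda>w. favg x0"]
    by (simp add: x_0 prob_space)
  finally have "(\<Sum>s<n. \<gamma> s * expectation (\<lambda>w. fw_gap C favg (x s w)))
      \<le> favg x0 - ?E n + Lc * Dc\<^sup>2 * (real K + 1 + ?\<kappa> / 2) * (\<Sum>s<n. \<sigma> s)" .
  \<comment> \<open>The last value of the telescoping sum is controlled because the iterate stays in
    \<open>C\<close>.\<close>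
  moreover have "(INF z\<in>C. favg z) \<le> ?E n"
    using integrable_avg[OF \<open>n \<le> T\<close>] INF_avg_le[OF x_in[OF \<open>n \<le> T\<close>]]
    by (intro integral_ge_const AE_I2) auto
  ultimately show ?thesis by linarith
qed

text \<open>All gaps up to time \<open>t\<close> are known by time \<open>T\<close>, and the output
  index is independent of \<open>F T\<close>, so it can be frozen. Integrability is recorded because
  the integral of a non-integrable function is 0 by convention, which would make a bound
  meaningless.\<close>

lemma expectation_random_iterate:
  assumes tau: "fresh_uniform_index (F T) t \<tau>" and "t \<le> T"
  shows "integrable M (\<lambda>w. fw_gap C favg (x (\<tau> w) w))"
    and "expectation (\<lambda>w. fw_gap C favg (x (\<tau> w) w))
      = (\<Sum>s<Suc t. expectation (\<lambda>w. fw_gap C favg (x s w))) / (real t + 1)"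
proof -
  have \<tau>: "random_variable (count_space {0..t}) \<tau>"
    and uniform: "distr M (count_space {0..t}) \<tau> = uniform_count_measure {0..t}"
    and indep: "indep_set (sets (F T)) (sets (vimage_algebra (space M) \<tau> (count_space {0..t})))"
    using tau by (auto simp: fresh_uniform_index_def)
  have event: "{w \<in> space M. \<tau> w = s} \<in> sets (vimage_algebra (space M) \<tau> (count_space {0..t}))"
    if "s \<in> {0..t}" for s
  proof -
    have "\<tau> -` {s} \<inter> space M \<in> sets (vimage_algebra (space M) \<tau> (count_space {0..t}))"
      using that by (intro in_vimage_algebra) auto
    also have "\<tau> -` {s} \<inter> space M = {w \<in> space M. \<tau> w = s}" by auto
    finally show ?thesis .
  qed
  have meas: "(\<lambda>w. fw_gap C favg (x s w)) \<in> borel_measurable (F T)" if "s \<in> {0..t}" for s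
  proof -
    have [measurable]: "x s \<in> borel_measurable (F T)"
      using that \<open>t \<le> T\<close> by (intro measurable_F_mono[OF _ x_measurable]) auto
    show ?thesis by measurable
  qed
  note disc = expectation_indep_discrete[OF indep space_F space_vimage_algebra,
      where S = "{0..t}" and \<phi> = "\<lambda>s w. fw_gap C favg (x s w)" and I = \<tau>]
  have in_range: "\<tau> w \<in> {0..t}" if "w \<in> space M" for w
    using measurable_space[OF \<tau> that] by simp
  show "integrable M (\<lambda>w. fw_gap C favg (x (\<tau> w) w))"
    using \<open>t \<le> T\<close> by (intro disc(1) in_range event meas integrable_gap) auto
  have "expectation (\<lambda>w. fw_gap C favg (x (\<tau> w) w))
      = (\<Sum>s\<in>{0..t}. prob {w \<in> space M. \<tau> w = s} * expectation (\<lambda>w. fw_gap C favg (x s w)))"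
    using \<open>t \<le> T\<close> by (intro disc(2) in_range event meas integrable_gap) auto
  also have "\<dots> = (\<Sum>s\<in>{0..t}. expectation (\<lambda>w. fw_gap C favg (x s w)) / (real t + 1))"
    using prob_uniform_eq[OF _ _ \<tau> uniform] by (intro sum.cong) (auto simp: add.commute)
  also have "\<dots> = (\<Sum>s<Suc t. expectation (\<lambda>w. fw_gap C favg (x s w))) / (real t + 1)"
    by (simp add: sum_divide_distrib atLeast0AtMost lessThan_Suc_atMost)
  finally show "expectation (\<lambda>w. fw_gap C favg (x (\<tau> w) w))
      = (\<Sum>s<Suc t. expectation (\<lambda>w. fw_gap C favg (x s w))) / (real t + 1)" .
qed

text \<open>The telescoped sum carries weights \<open>\<gamma> s\<close>, the random output carries
  equal ones. Since the gaps are nonnegative and \<open>\<gamma> t\<close> is the smallest weight,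
  all weights are lowered to it.\<close>

lemma random_iterate_gap_le:
  assumes eta: "\<And>t. \<eta> t = lm t / Lc" and t: "t < T"
    and batch: "\<And>s. s \<le> t \<Longrightarrow> Gc / sqrt (real (b s)) \<le> Lc * Dc * \<delta> s"
    and \<sigma>: "\<And>s. s \<le> t \<Longrightarrow> \<gamma> s * \<delta> s \<le> \<sigma> s" "\<And>s. s \<le> t \<Longrightarrow> (\<gamma> s)\<^sup>2 \<le> \<sigma> s"
    and \<gamma>: "0 < \<gamma> t" "\<And>s. s \<le> t \<Longrightarrow> \<gamma> t \<le> \<gamma> s"
    and tau: "fresh_uniform_index (F T) t \<tau>"
  shows "expectation (\<lambda>w. fw_gap C favg (x (\<tau> w) w))
    \<le> (favg x0 - (INF z\<in>C. favg z) + Lc * Dc\<^sup>2 * (real K + 1 + (lp 0 / lm 0) / 2) * (\<Sum>s\<le>t. \<sigma> s))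
      / (\<gamma> t * (real t + 1))"
proof -
  let ?e = "\<lambda>s. expectation (\<lambda>w. fw_gap C favg (x s w))"
  have e0: "0 \<le> ?e s" if "s < Suc t" for s
    using fw_gap_bounds(1)[OF x_in] that t by (intro integral_nonneg_AE AE_I2) auto
  have "\<gamma> t * (\<Sum>s<Suc t. ?e s) \<le> (\<Sum>s<Suc t. \<gamma> s * ?e s)"
    unfolding sum_distrib_left using e0 \<gamma>(2) by (intro sum_mono mult_right_mono) auto
  also have "\<dots> \<le> favg x0 - (INF z\<in>C. favg z)
      + Lc * Dc\<^sup>2 * (real K + 1 + (lp 0 / lm 0) / 2) * (\<Sum>s<Suc t. \<sigma> s)"
    using t batch \<sigma> by (intro sum_gap_le[where \<delta> = \<delta>] eta) auto
  finally have "\<gamma> t * (\<Sum>s<Suc t. ?e s) / (\<gamma> t * (real t + 1)) \<le> (favg x0 - (INF z\<in>C. favg z)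
      + Lc * Dc\<^sup>2 * (real K + 1 + (lp 0 / lm 0) / 2) * (\<Sum>s<Suc t. \<sigma> s)) / (\<gamma> t * (real t + 1))"
    using \<gamma>(1) by (intro divide_right_mono) auto
  then show ?thesis
    using expectation_random_iterate(2)[OF tau] t \<gamma>(1) by (simp add: lessThan_Suc_atMost)
qed

text \<open>Used with \<open>c = t + 1\<close> and \<open>c = T\<close>; an inequality suffices as
  hypothesis, so rounding the batch size up does no harm.\<close>

lemma batch_bound:
  assumes "(Gc / (Lc * Dc))\<^sup>2 * c \<le> real (b t)" "0 < c"
  shows "Gc / sqrt (real (b t)) \<le> Lc * Dc * (1 / sqrt c)"
proof -
  have "Gc / (Lc * Dc) * sqrt c = sqrt ((Gc / (Lc * Dc))\<^sup>2 * c)"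
    using G_pos L_pos D_pos by (simp add: real_sqrt_mult)
  also have "\<dots> \<le> sqrt (real (b t))" using assms(1) by simp
  finally show ?thesis
    using G_pos L_pos D_pos assms(2) b_pos[of t] by (simp add: field_simps)
qed

end

section \<open>The two step-size schedules\<close>

lemma summable_inverse_Suc_powr:
  assumes "1 < (a::real)"
  shows "summable (\<lambda>s. 1 / (real s + 1) powr a)"
proof -
  have "summable (\<lambda>n. real n powr - a)" using assms by (simp add: summable_real_powr_iff)
  then have "summable (\<lambda>n. real (Suc n) powr - a)" by (subst summable_Suc_iff)
  then show ?thesis by (simp add: powr_minus_divide add.commute)
qed

theorem theorem3p3:
  fixes C :: "(real ^ 'n) set" and m :: nat and f :: "nat \<Rightarrow> real ^ 'n \<Rightarrow> real"
    and M :: "'w measure" and F :: "nat \<Rightarrow> 'w measure"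
    and T :: nat and x0 :: "real ^ 'n" and b :: "nat \<Rightarrow> nat"
    and lm lp :: "nat \<Rightarrow> real" and K :: nat and \<eta> \<gamma> :: "nat \<Rightarrow> real"
    and idx :: "nat \<Rightarrow> nat \<Rightarrow> 'w \<Rightarrow> nat" and H :: "nat \<Rightarrow> 'w \<Rightarrow> real ^ 'n ^ 'n"
    and y v :: "nat \<Rightarrow> nat \<Rightarrow> 'w \<Rightarrow> real ^ 'n" and x :: "nat \<Rightarrow> 'w \<Rightarrow> real ^ 'n"
    and \<tau> :: "nat \<Rightarrow> 'w \<Rightarrow> nat" and X :: "nat \<Rightarrow> 'w \<Rightarrow> real ^ 'n"
    and D G L \<kappa> fmin :: real
  assumes run: "adasfw C m f M F T x0 b lm lp K \<eta> \<gamma> idx H y v x"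
    and D: "D = diameter C"
    and G: "G = grad_bound C m f"
    and L: "L = smoothness_const C m f"
    and fmin: "fmin = (INF z \<in> C. avg m f z)"
    and eta: "\<And>t. \<eta> t = lm t / L"
    and kappa: "\<kappa> = lp 0 / lm 0"
    and tau: "\<And>t. t \<le> T \<Longrightarrow> prob_space.fresh_uniform_index M (F T) t (\<tau> t)"
    and X: "\<And>t w. t \<le> T \<Longrightarrow> w \<in> space M \<Longrightarrow> X t w = x (\<tau> t w) w"
  shows
    "(\<forall>\<nu>\<in>{0<..<1/2}.
        (\<forall>t. b t = nat \<lceil>(G / (L * D))\<^sup>2 * (real t + 1)\<rceil>) \<and>
        (\<forall>t. \<gamma> t = 1 / (real t + 1) powr (1/2 + \<nu>)) \<longrightarrow>
        summable (\<lambda>s. 1 / (real s + 1) powr (1 + \<nu>)) \<and>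
        0 \<le> (\<Sum>s. 1 / (real s + 1) powr (1 + \<nu>)) \<and>
        (\<forall>t\<in>{0..T-1}.
           integrable M (\<lambda>w. fw_gap C (avg m f) (X t w)) \<and>
           (\<integral>w. fw_gap C (avg m f) (X t w) \<partial>M)
             \<le> ((avg m f x0 - fmin) +
                 L * D\<^sup>2 * (real K + 1 + \<kappa> / 2) * (\<Sum>s. 1 / (real s + 1) powr (1 + \<nu>)))
               / (real t + 1) powr (1/2 - \<nu>)))
     \<and>
     ((\<forall>t. b t = nat \<lceil>(G / (L * D))\<^sup>2 * real T\<rceil>) \<and> (\<forall>t. \<gamma> t = 1 / sqrt (real T)) \<longrightarrow>
        integrable M (\<lambda>w. fw_gap C (avg m f) (X (T-1) w)) \<and>
        (\<integral>w. fw_gap C (avg m f) (X (T-1) w) \<partial>M)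
          \<le> ((avg m f x0 - fmin) + L * D\<^sup>2 * (real K + 1 + \<kappa> / 2)) / sqrt (real T))"
proof -
  \<comment> \<open>The last two arguments instantiate \<open>sgrad\<close> and \<open>Q\<close>,
    which the locale fixes by \<open>defines\<close> and which are therefore absent from the
    predicate in \<open>run\<close>.\<close>
  interpret adasfw C m f M F T x0 b lm lp K \<eta> \<gamma> idx H y v x
    "\<lambda>t w. (1 / real (b t)) *\<^sub>R (\<Sum>j<b t. grad (f (idx t j w)) (x t w))"
    "\<lambda>t w. quad_model (avg m f (x t w)) ((1 / real (b t)) *\<^sub>R (\<Sum>j<b t. grad (f (idx t j w)) (x t w)))
      (\<eta> t) (H t w) (x t w)"
    by (rule run)
  have pos: "0 < G" "0 < L" "0 < D" using G_pos L_pos D_pos by (simp_all add: G L D)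
  have eta': "\<eta> t = lm t / Lc" for t using eta L by simp
  have X_eq: "(\<integral>w. fw_gap C favg (X t w) \<partial>M) = expectation (\<lambda>w. fw_gap C favg (x (\<tau> t w) w))"
    "integrable M (\<lambda>w. fw_gap C favg (X t w)) \<longleftrightarrow> integrable M (\<lambda>w. fw_gap C favg (x (\<tau> t w) w))"
    if "t \<le> T" for t
    using X[OF that] by (auto intro!: Bochner_Integration.integral_cong Bochner_Integration.integrable_cong)
  have int: "integrable M (\<lambda>w. fw_gap C favg (X t w))" if "t \<le> T" for t
    using X_eq(2) expectation_random_iterate(1)[OF tau] that by simp
  note gap_le = random_iterate_gap_le[OF eta', folded D L kappa fmin]
  have part1: "integrable M (\<lambda>w. fw_gap C favg (X t w)) \<and> (\<integral>w. fw_gap C favg (X t w) \<partial>M)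
      \<le> ((favg x0 - fmin) + L * D\<^sup>2 * (real K + 1 + \<kappa> / 2) * (\<Sum>s. 1 / (real s + 1) powr (1 + \<nu>)))
        / (real t + 1) powr (1/2 - \<nu>)"
    if \<nu>: "\<nu> \<in> {0<..<1/2}" and b: "\<And>t. b t = nat \<lceil>(G / (L * D))\<^sup>2 * (real t + 1)\<rceil>"
      and \<gamma>: "\<And>t. \<gamma> t = 1 / (real t + 1) powr (1/2 + \<nu>)" and t: "t \<in> {0..T-1}" for \<nu> t
  proof (intro conjI)
    let ?\<sigma> = "\<lambda>s. 1 / (real s + 1) powr (1 + \<nu>)"
    have tT: "t < T" using t T_pos by auto
    then show "integrable M (\<lambda>w. fw_gap C favg (X t w))" by (intro int) simp
    have "expectation (\<lambda>w. fw_gap C favg (x (\<tau> t w) w))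
        \<le> (favg x0 - fmin + L * D\<^sup>2 * (real K + 1 + \<kappa> / 2) * (\<Sum>s\<le>t. ?\<sigma> s)) / (\<gamma> t * (real t + 1))"
    \<comment> \<open>The growing batches give relative error \<open>1 / sqrt (s + 1)\<close>, whose
      product with \<open>\<gamma> s\<close> is exactly \<open>?\<sigma> s\<close>; the square of
      \<open>\<gamma> s\<close> has the larger exponent \<open>1 + 2 * \<nu>\<close>.\<close>
    proof (rule gap_le[where \<delta> = "\<lambda>s. 1 / sqrt (real s + 1)", OF tT])
      show "fresh_uniform_index (F T) t (\<tau> t)" using tau tT by simp
      show "0 < \<gamma> t" by (simp add: \<gamma>)
      fix s assume "s \<le> t"
      show "Gc / sqrt (real (b s)) \<le> L * D * (1 / sqrt (real s + 1))"
        unfolding L D by (rule batch_bound) (simp_all add: b real_nat_ceiling_ge G L D)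
      have "\<gamma> s * (1 / sqrt (real s + 1)) = 1 / ((real s + 1) powr (1/2 + \<nu>) * (real s + 1) powr (1/2))"
        by (simp add: \<gamma> powr_half_sqrt)
      also have "\<dots> = ?\<sigma> s" by (simp flip: powr_add)
      finally show "\<gamma> s * (1 / sqrt (real s + 1)) \<le> ?\<sigma> s" by simp
      have "(\<gamma> s)\<^sup>2 = 1 / (real s + 1) powr (1 + 2 * \<nu>)"
        by (simp add: \<gamma> power2_eq_square flip: powr_add)
      also have "\<dots> \<le> ?\<sigma> s"
        using \<nu> by (intro divide_left_mono powr_mono mult_pos_pos) auto
      finally show "(\<gamma> s)\<^sup>2 \<le> ?\<sigma> s" .
      show "\<gamma> t \<le> \<gamma> s"
        unfolding \<gamma> using \<nu> \<open>s \<le> t\<close> by (intro divide_left_mono powr_mono2 mult_pos_pos) auto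
    qed
    also have "\<gamma> t * (real t + 1) = (real t + 1) powr (1/2 - \<nu>)"
    proof -
      have "(real t + 1) powr (1/2 - \<nu>) = (real t + 1) powr (1 - (1/2 + \<nu>))"
        by (simp add: field_simps)
      also have "\<dots> = (real t + 1) / (real t + 1) powr (1/2 + \<nu>)"
        by (subst powr_diff) simp
      finally show ?thesis by (simp add: \<gamma>)
    qed
    also have "(favg x0 - fmin + L * D\<^sup>2 * (real K + 1 + \<kappa> / 2) * (\<Sum>s\<le>t. ?\<sigma> s)) / (real t + 1) powr (1/2 - \<nu>)
        \<le> (favg x0 - fmin + L * D\<^sup>2 * (real K + 1 + \<kappa> / 2) * (\<Sum>s. ?\<sigma> s)) / (real t + 1) powr (1/2 - \<nu>)"
    proof -
      \<comment> \<open>Passing to the full series makes the numerator independent of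
        \<open>t\<close>; the coefficient in front is nonnegative because \<open>\<kappa>\<close>
        is.\<close>
      have "(\<Sum>s\<le>t. ?\<sigma> s) \<le> (\<Sum>s. ?\<sigma> s)"
        using \<nu> by (intro sum_le_suminf summable_inverse_Suc_powr) auto
      moreover have "0 \<le> \<kappa>" unfolding kappa using lambda[of 0] by (intro divide_nonneg_nonneg) auto
      ultimately show ?thesis
        using pos by (intro divide_right_mono add_left_mono mult_left_mono) auto
    qed
    finally show "(\<integral>w. fw_gap C favg (X t w) \<partial>M)
      \<le> ((favg x0 - fmin) + L * D\<^sup>2 * (real K + 1 + \<kappa> / 2) * (\<Sum>s. ?\<sigma> s)) / (real t + 1) powr (1/2 - \<nu>)"
      using X_eq(1)[of t] tT by simp
  qed
  have part2: "integrable M (\<lambda>w. fw_gap C favg (X (T-1) w)) \<and> (\<integral>w. fw_gap C favg (X (T-1) w) \<partial>M)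
      \<le> ((favg x0 - fmin) + L * D\<^sup>2 * (real K + 1 + \<kappa> / 2)) / sqrt (real T)"
    if b: "\<And>t. b t = nat \<lceil>(G / (L * D))\<^sup>2 * real T\<rceil>" and \<gamma>: "\<And>t. \<gamma> t = 1 / sqrt (real T)"
  proof (intro conjI int)
    have T1: "T - 1 < T" "real (T - 1) + 1 = real T" using T_pos by auto
    have "expectation (\<lambda>w. fw_gap C favg (x (\<tau> (T-1) w) w))
        \<le> (favg x0 - fmin + L * D\<^sup>2 * (real K + 1 + \<kappa> / 2) * (\<Sum>s\<le>T-1. 1 / real T))
          / (\<gamma> (T-1) * (real (T-1) + 1))"
    \<comment> \<open>With constant batches and steps, \<open>\<gamma> s * \<delta> s\<close> and
      the square of \<open>\<gamma> s\<close> both equal \<open>1 / T\<close>.\<close>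
    proof (rule gap_le[where \<delta> = "\<lambda>s. 1 / sqrt (real T)", OF T1(1)])
      show "fresh_uniform_index (F T) (T-1) (\<tau> (T-1))" by (rule tau) simp
      show "0 < \<gamma> (T-1)" using T_pos by (simp add: \<gamma>)
      fix s
      show "Gc / sqrt (real (b s)) \<le> L * D * (1 / sqrt (real T))"
        unfolding L D using T_pos by (intro batch_bound) (simp_all add: b real_nat_ceiling_ge G L D)
      show "\<gamma> s * (1 / sqrt (real T)) \<le> 1 / real T" "(\<gamma> s)\<^sup>2 \<le> 1 / real T" "\<gamma> (T-1) \<le> \<gamma> s"
        by (simp_all add: \<gamma> power_divide)
    qed
    also have "\<gamma> (T-1) * (real (T-1) + 1) = sqrt (real T)"
      using T_pos unfolding T1 \<gamma> by (simp add: real_div_sqrt)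
    \<comment> \<open>As \<open>T \<ge> 1\<close>, the truncated subtraction is genuine and the
      range has exactly \<open>T\<close> terms.\<close>
    also have "(\<Sum>s\<le>T-1. 1 / real T) = 1"
      using T_pos T1(2) by (simp add: add.commute)
    finally show "(\<integral>w. fw_gap C favg (X (T-1) w) \<partial>M)
      \<le> ((favg x0 - fmin) + L * D\<^sup>2 * (real K + 1 + \<kappa> / 2)) / sqrt (real T)"
      using X_eq(1)[of "T-1"] by simp
  qed simp
  show ?thesis
  proof (intro conjI ballI impI; (elim conjE)?)
    fix \<nu> :: real assume "\<nu> \<in> {0<..<1/2}"
    then show "summable (\<lambda>s. 1 / (real s + 1) powr (1 + \<nu>))"
      by (intro summable_inverse_Suc_powr) auto
    then show "0 \<le> (\<Sum>s. 1 / (real s + 1) powr (1 + \<nu>))"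
      by (intro suminf_nonneg) auto
  qed (use part1 part2 in blast)+
qed

end
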